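(* Let $1\le p\le 2$, let $\sigma_1,\sigma_2\in L^p[0,1]$ be complex-valued, and let $r\ge0$. Let $\mathbf c=[c_1,c_2]^T$ and $\mathbf s=[s_1,s_2]^T$ be the solutions of the Dirac system $$y_1'+\sigma_1y_2=i\mu y_1,\qquad y_2'+\sigma_2y_1=-i\mu y_2\qquad\text{on }[0,1]$$ satisfying $c_1(0)=1$, $c_2(0)=0$ and $s_1(0)=0$, $s_2(0)=1$, respectively. If $\mu\in\Sigma_r$ and $|\mu|\to\infty$, then the following formulas hold uniformly in $x\in[0,1]$: $$c_1(x)=e^{i\mu x}\Big(1+\int_0^xe^{-2i\mu s}\sigma_1(s)\int_0^se^{2i\mu\xi}\sigma_2(\xi)\,d\xi\,ds\Big)+e^{-i\mu x}Q(x,\mu)+e^{-i\mu x}\mathrm O(\widetilde\gamma(\mu)),$$ $$c_2(x)=e^{-i\mu x}\Big(-\int_0^xe^{2i\mu t}\sigma_2(t)\,dt-\int_0^xe^{2i\mu t}\sigma_2(t)\int_0^te^{-2i\mu s}\sigma_1(s)\int_0^se^{2i\mu\tau}\sigma_2(\tau)\,d\tau\,ds\,dt\Big)+e^{-i\mu x}\mathrm O(\widetilde\gamma(\mu)),$$ $$s_1(x)=e^{i\mu x}\Big(-\int_0^xe^{-2i\mu t}\sigma_1(t)\,dt-\int_0^xe^{2i\mu s}\sigma_2(s)\int_s^xe^{-2i\mu t}\sigma_1(t)\int_0^se^{-2i\mu\tau}\sigma_1(\tau)\,d\tau\,dt\,ds\Big)+e^{-i\mu x}\mathrm O(\widetilde\gamma(\mu)),$$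 $$s_2(x)=e^{-i\mu x}\Big(1+\int_0^x\sigma_2(t)e^{2i\mu t}\int_0^t\sigma_1(s)e^{-2i\mu s}\,ds\,dt\Big)+e^{-i\mu x}\mathrm O(\widetilde\gamma(\mu)),$$ where $$Q(x,\mu)=\int_0^xe^{2i\mu(x-t)}\sigma_1(t)\int_0^t\sigma_2(s)\int_0^se^{2i\mu(s-\tau)}\sigma_1(\tau)\int_0^\tau e^{2i\mu y}\sigma_2(y)\,dy\,d\tau\,ds\,dt.$$
   Context: Solutions of the system are pairs of absolutely continuous functions on $[0,1]$ satisfying the equations almost everywhere. $\Sigma_r=\{\mu\in\mathbb C:\operatorname{Im}\mu>-r\}$. Define $$\gamma_{0,1}(x,\mu)=\Big|\int_0^xe^{2i\mu(x-t)}\sigma_1(t)\,dt\Big|,\qquad \gamma_{0,2}(x,\mu)=\Big|\int_x^1e^{2i\mu(t-x)}\sigma_2(t)\,dt\Big|,$$ $$\widetilde\gamma(\mu)=\int_0^1|\sigma_2(s)|\gamma_{0,1}^2(s,\mu)\,ds+\int_0^1|\sigma_1(s)|\gamma_{0,2}^2(s,\mu)\,ds.$$ $\mathrm O(\widetilde\gamma(\mu))$, uniformly in $x$, denotes a function of $(x,\mu)$ bounded in absolute value by $C\widetilde\gamma(\mu)$ for all $x\in[0,1]$ and all $\mu\in\Sigma_r$ with $|\mu|$ sufficiently large, with $C$ independent of $x$ and $\mu$. *)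

theory Defs
  imports "HOL-Analysis.Analysis"
begin

text \<open>Absolute continuity in the usual epsilon-delta sense, over finite families of
  non-overlapping subintervals (degenerate ones are allowed and contribute nothing).\<close>

definition abs_continuous_on_interval ::
    "real \<Rightarrow> real \<Rightarrow> (real \<Rightarrow> 'a::real_normed_vector) \<Rightarrow> bool" where
  "abs_continuous_on_interval u v f \<longleftrightarrow>
     (\<forall>\<epsilon>>0. \<exists>\<delta>>0. \<forall>(I::nat set) a b.
        finite I \<and> (\<forall>i\<in>I. u \<le> a i \<and> a i \<le> b i \<and> b i \<le> v) \<and>
        disjoint_family_on (\<lambda>i. {a i<..<b i}) I \<and> (\<Sum>i\<in>I. b i - a i) < \<delta>
        \<longrightarrow> (\<Sum>i\<in>I. norm (f (b i) - f (a i))) < \<epsilon>)"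

definition Lp01 :: "real \<Rightarrow> (real \<Rightarrow> complex) set" where
  "Lp01 p = {f. f \<in> borel_measurable (lebesgue_on {0..1}) \<and>
                integrable (lebesgue_on {0..1}) (\<lambda>x. cmod (f x) powr p)}"

definition dirac_solution ::
    "(real \<Rightarrow> complex) \<Rightarrow> (real \<Rightarrow> complex) \<Rightarrow> complex \<Rightarrow>
     (real \<Rightarrow> complex) \<Rightarrow> (real \<Rightarrow> complex) \<Rightarrow> bool" where
  "dirac_solution \<sigma>\<^sub>1 \<sigma>\<^sub>2 \<mu> y\<^sub>1 y\<^sub>2 \<longleftrightarrow>
     abs_continuous_on_interval 0 1 y\<^sub>1 \<and> abs_continuous_on_interval 0 1 y\<^sub>2 \<and>
     (AE x in lebesgue_on {0..1}. \<exists>d\<^sub>1 d\<^sub>2.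
        (y\<^sub>1 has_vector_derivative d\<^sub>1) (at x within {0..1}) \<and>
        (y\<^sub>2 has_vector_derivative d\<^sub>2) (at x within {0..1}) \<and>
        d\<^sub>1 + \<sigma>\<^sub>1 x * y\<^sub>2 x = \<i> * \<mu> * y\<^sub>1 x \<and>
        d\<^sub>2 + \<sigma>\<^sub>2 x * y\<^sub>1 x = - \<i> * \<mu> * y\<^sub>2 x)"

definition Sigma_half_plane :: "real \<Rightarrow> complex set" where
  "Sigma_half_plane r = {\<mu>. Im \<mu> > - r}"

definition gamma01 :: "(real \<Rightarrow> complex) \<Rightarrow> real \<Rightarrow> complex \<Rightarrow> real" where
  "gamma01 \<sigma>\<^sub>1 x \<mu> =
     cmod (LINT t:{0..x}|lebesgue. exp (2 * \<i> * \<mu> * of_real (x - t)) * \<sigma>\<^sub>1 t)"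

definition gamma02 :: "(real \<Rightarrow> complex) \<Rightarrow> real \<Rightarrow> complex \<Rightarrow> real" where
  "gamma02 \<sigma>\<^sub>2 x \<mu> =
     cmod (LINT t:{x..1}|lebesgue. exp (2 * \<i> * \<mu> * of_real (t - x)) * \<sigma>\<^sub>2 t)"

definition gamma_tilde :: "(real \<Rightarrow> complex) \<Rightarrow> (real \<Rightarrow> complex) \<Rightarrow> complex \<Rightarrow> real" where
  "gamma_tilde \<sigma>\<^sub>1 \<sigma>\<^sub>2 \<mu> =
     (LINT s:{0..1}|lebesgue. cmod (\<sigma>\<^sub>2 s) * (gamma01 \<sigma>\<^sub>1 s \<mu>)\<^sup>2) +
     (LINT s:{0..1}|lebesgue. cmod (\<sigma>\<^sub>1 s) * (gamma02 \<sigma>\<^sub>2 s \<mu>)\<^sup>2)"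

definition Q_term ::
    "(real \<Rightarrow> complex) \<Rightarrow> (real \<Rightarrow> complex) \<Rightarrow> real \<Rightarrow> complex \<Rightarrow> complex" where
  "Q_term \<sigma>\<^sub>1 \<sigma>\<^sub>2 x \<mu> =
     (LINT t:{0..x}|lebesgue. exp (2 * \<i> * \<mu> * of_real (x - t)) * \<sigma>\<^sub>1 t *
       (LINT s:{0..t}|lebesgue. \<sigma>\<^sub>2 s *
         (LINT \<tau>:{0..s}|lebesgue. exp (2 * \<i> * \<mu> * of_real (s - \<tau>)) * \<sigma>\<^sub>1 \<tau> *
           (LINT y:{0..\<tau>}|lebesgue. exp (2 * \<i> * \<mu> * of_real y) * \<sigma>\<^sub>2 y))))"

text \<open>The class \<open>O(g(\<mu>))\<close>, uniform in \<open>x\<close>, as \<open>|\<mu>|\<close> tends to infinity inside the half-plane.\<close>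

definition bigO_unif :: "real \<Rightarrow> (complex \<Rightarrow> real) \<Rightarrow> (real \<Rightarrow> complex \<Rightarrow> complex) set" where
  "bigO_unif r g = {E. \<exists>C R. \<forall>x\<in>{0..1}. \<forall>\<mu>\<in>Sigma_half_plane r.
                      cmod \<mu> \<ge> R \<longrightarrow> cmod (E x \<mu>) \<le> C * g \<mu>}"

end

theory Submission
  imports Defs
begin

text \<open>Put \<open>u(x) = e\<^bsup>-i\<mu>x\<^esup> y\<^sub>1(x)\<close>, \<open>v(x) = e\<^bsup>i\<mu>x\<^esup> y\<^sub>2(x)\<close>, \<open>\<alpha>(t) = e\<^bsup>-2i\<mu>t\<^esup> \<sigma>\<^sub>1(t)\<close> and
  \<open>\<beta>(t) = e\<^bsup>2i\<mu>t\<^esup> \<sigma>\<^sub>2(t)\<close>. The system becomes \<open>u' = -\<alpha> v\<close>, \<open>v' = -\<beta> u\<close>, that is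
  \<open>v = y\<^sub>2(0) - y\<^sub>1(0) H + T v\<close> with \<open>H = \<integral>\<beta>\<close> and \<open>T f(x) = \<integral>\<^sub>0\<^sup>x \<beta>(s) \<integral>\<^sub>0\<^sup>s \<alpha>(t) f(t) dt ds\<close>.
  The kernel of \<open>T\<close> is bounded uniformly on the half-plane, and the claimed formulas are the first two
  terms of the Neumann series. By Gronwall's inequality the remainder is controlled by \<open>T (T H)\<close> and
  \<open>T (T 1)\<close>. Integrating by parts expresses these through \<open>A = \<integral>\<alpha>\<close> and \<open>K = T 1 = \<integral>\<beta> A\<close>, with every
  term quadratic in \<open>\<beta> A\<close>; since \<open>\<bar>\<beta> A\<bar> = \<bar>\<sigma>\<^sub>2\<bar> \<gamma>\<^sub>0\<^sub>,\<^sub>1\<close>, the Cauchy-Schwarz inequality bounds all of them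
  by the first summand of \<open>gamma_tilde\<close>. The other component follows from \<open>u = y\<^sub>1(0) - \<integral>\<alpha> v\<close>.\<close>

hide_const (open) Polynomial.content

section \<open>Absolutely continuous functions\<close>

lemma abs_continuous_on_intervalD:
  assumes "abs_continuous_on_interval u v f" "0 < \<epsilon>"
  obtains \<delta> where "0 < \<delta>"
    "\<And>(I::nat set) a b. finite I \<Longrightarrow> (\<And>i. i \<in> I \<Longrightarrow> u \<le> a i \<and> a i \<le> b i \<and> b i \<le> v) \<Longrightarrow>
       disjoint_family_on (\<lambda>i. {a i<..<b i}) I \<Longrightarrow> (\<Sum>i\<in>I. b i - a i) < \<delta> \<Longrightarrow>
       (\<Sum>i\<in>I. norm (f (b i) - f (a i))) < \<epsilon>"
proof -
  from assms(1)[unfolded abs_continuous_on_interval_def, rule_format, OF assms(2)]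
  obtain \<delta> where \<delta>: "0 < \<delta>"
    "\<forall>(I::nat set) a b.
       finite I \<and> (\<forall>i\<in>I. u \<le> a i \<and> a i \<le> b i \<and> b i \<le> v) \<and>
       disjoint_family_on (\<lambda>i. {a i<..<b i}) I \<and> (\<Sum>i\<in>I. b i - a i) < \<delta>
       \<longrightarrow> (\<Sum>i\<in>I. norm (f (b i) - f (a i))) < \<epsilon>"
    by (elim exE conjE)
  show thesis
    by (rule that[OF \<delta>(1)]) (simp add: \<delta>(2)[rule_format])
qed

lemma abs_continuous_on_interval_subset:
  assumes "abs_continuous_on_interval u v f" "u \<le> u'" "v' \<le> v"
  shows "abs_continuous_on_interval u' v' f"
  unfolding abs_continuous_on_interval_def
proof (intro allI impI)
  fix \<epsilon> :: real
  assume "0 < \<epsilon>"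
  with assms(1) obtain \<delta> where \<delta>: "0 < \<delta>"
    "\<And>(I::nat set) a b. finite I \<Longrightarrow> (\<And>i. i \<in> I \<Longrightarrow> u \<le> a i \<and> a i \<le> b i \<and> b i \<le> v) \<Longrightarrow>
       disjoint_family_on (\<lambda>i. {a i<..<b i}) I \<Longrightarrow> (\<Sum>i\<in>I. b i - a i) < \<delta> \<Longrightarrow>
       (\<Sum>i\<in>I. norm (f (b i) - f (a i))) < \<epsilon>"
    by (rule abs_continuous_on_intervalD) blast
  show "\<exists>\<delta>>0. \<forall>(I::nat set) a b. finite I \<and> (\<forall>i\<in>I. u' \<le> a i \<and> a i \<le> b i \<and> b i \<le> v') \<and>
      disjoint_family_on (\<lambda>i. {a i<..<b i}) I \<and> (\<Sum>i\<in>I. b i - a i) < \<delta> \<longrightarrow>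
      (\<Sum>i\<in>I. norm (f (b i) - f (a i))) < \<epsilon>"
  proof (intro exI[of _ \<delta>] conjI allI impI, fact \<delta>(1))
    fix I :: "nat set" and a b
    assume *: "finite I \<and> (\<forall>i\<in>I. u' \<le> a i \<and> a i \<le> b i \<and> b i \<le> v') \<and>
      disjoint_family_on (\<lambda>i. {a i<..<b i}) I \<and> (\<Sum>i\<in>I. b i - a i) < \<delta>"
    show "(\<Sum>i\<in>I. norm (f (b i) - f (a i))) < \<epsilon>"
    proof (rule \<delta>(2))
      show "u \<le> a i \<and> a i \<le> b i \<and> b i \<le> v" if "i \<in> I" for i
        using * that assms(2,3) by force
    qed (use * in auto)
  qed
qed

lemma abs_continuous_on_interval_imp_continuous_on:
  fixes f :: "real \<Rightarrow> 'a::real_normed_vector"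
  assumes "abs_continuous_on_interval u v f"
  shows "continuous_on {u..v} f"
  unfolding continuous_on_iff
proof (intro ballI allI impI)
  fix x and e :: real
  assume x: "x \<in> {u..v}" and "0 < e"
  from assms this(2) obtain \<delta> where "0 < \<delta>" and
    \<delta>: "\<And>(I::nat set) a b. finite I \<Longrightarrow> (\<And>i. i \<in> I \<Longrightarrow> u \<le> a i \<and> a i \<le> b i \<and> b i \<le> v) \<Longrightarrow>
       disjoint_family_on (\<lambda>i. {a i<..<b i}) I \<Longrightarrow> (\<Sum>i\<in>I. b i - a i) < \<delta> \<Longrightarrow>
       (\<Sum>i\<in>I. norm (f (b i) - f (a i))) < e"
    by (rule abs_continuous_on_intervalD) blast
  have "dist (f y) (f x) < e" if y: "y \<in> {u..v}" "dist y x < \<delta>" for y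
    \<comment> \<open>A one-member family: the interval between x and y, with \<open>min\<close> and
      \<open>max\<close> putting its ends in order.\<close>
    using \<delta>[of "{0}" "\<lambda>_. min x y" "\<lambda>_. max x y"] x y
    by (cases "x \<le> y") (auto simp: disjoint_family_on_def dist_norm norm_minus_commute)
  then show "\<exists>d>0. \<forall>y\<in>{u..v}. dist y x < d \<longrightarrow> dist (f y) (f x) < e"
    using \<open>0 < \<delta>\<close> by blast
qed

lemma continuous_on_Icc_norm_bound:
  fixes f :: "real \<Rightarrow> 'a::real_normed_vector"
  assumes "continuous_on {u..v} f"
  obtains B where "0 < B" "\<And>x. x \<in> {u..v} \<Longrightarrow> norm (f x) \<le> B"
proof -
  have "bounded (f ` {u..v})"
    using assms by (intro compact_imp_bounded compact_continuous_image compact_Icc)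
  then show thesis
    using that by (auto simp: bounded_pos)
qed

lemma abs_continuous_on_interval_mult:
  fixes f g :: "real \<Rightarrow> 'a::real_normed_algebra"
  assumes f: "abs_continuous_on_interval u v f" and g: "abs_continuous_on_interval u v g"
  shows "abs_continuous_on_interval u v (\<lambda>x. f x * g x)"
  unfolding abs_continuous_on_interval_def
proof (intro allI impI)
  fix \<epsilon> :: real
  assume "0 < \<epsilon>"
  obtain B where B: "0 < B" "\<And>x. x \<in> {u..v} \<Longrightarrow> norm (f x) \<le> B"
    using continuous_on_Icc_norm_bound[OF abs_continuous_on_interval_imp_continuous_on[OF f]] by blast
  obtain C where C: "0 < C" "\<And>x. x \<in> {u..v} \<Longrightarrow> norm (g x) \<le> C"
    using continuous_on_Icc_norm_bound[OF abs_continuous_on_interval_imp_continuous_on[OF g]] by blast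
  \<comment> \<open>The variation of each factor gets multiplied by the bound of the other one, so
    each is allowed \<epsilon>/2 divided by that bound.\<close>
  have "0 < \<epsilon> / (2 * C)" "0 < \<epsilon> / (2 * B)"
    using \<open>0 < \<epsilon>\<close> B(1) C(1) by simp_all
  from f this(1) obtain \<delta> where \<delta>: "0 < \<delta>"
    "\<And>(I::nat set) a b. finite I \<Longrightarrow> (\<And>i. i \<in> I \<Longrightarrow> u \<le> a i \<and> a i \<le> b i \<and> b i \<le> v) \<Longrightarrow>
       disjoint_family_on (\<lambda>i. {a i<..<b i}) I \<Longrightarrow> (\<Sum>i\<in>I. b i - a i) < \<delta> \<Longrightarrow>
       (\<Sum>i\<in>I. norm (f (b i) - f (a i))) < \<epsilon> / (2 * C)"
    by (rule abs_continuous_on_intervalD) blast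
  from g \<open>0 < \<epsilon> / (2 * B)\<close> obtain \<eta> where \<eta>: "0 < \<eta>"
    "\<And>(I::nat set) a b. finite I \<Longrightarrow> (\<And>i. i \<in> I \<Longrightarrow> u \<le> a i \<and> a i \<le> b i \<and> b i \<le> v) \<Longrightarrow>
       disjoint_family_on (\<lambda>i. {a i<..<b i}) I \<Longrightarrow> (\<Sum>i\<in>I. b i - a i) < \<eta> \<Longrightarrow>
       (\<Sum>i\<in>I. norm (g (b i) - g (a i))) < \<epsilon> / (2 * B)"
    by (rule abs_continuous_on_intervalD) blast
  show "\<exists>\<delta>>0. \<forall>(I::nat set) a b. finite I \<and> (\<forall>i\<in>I. u \<le> a i \<and> a i \<le> b i \<and> b i \<le> v) \<and>
      disjoint_family_on (\<lambda>i. {a i<..<b i}) I \<and> (\<Sum>i\<in>I. b i - a i) < \<delta> \<longrightarrow>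
      (\<Sum>i\<in>I. norm (f (b i) * g (b i) - f (a i) * g (a i))) < \<epsilon>"
  proof (intro exI[of _ "min \<delta> \<eta>"] conjI allI impI)
    fix I :: "nat set" and a b
    assume *: "finite I \<and> (\<forall>i\<in>I. u \<le> a i \<and> a i \<le> b i \<and> b i \<le> v) \<and>
      disjoint_family_on (\<lambda>i. {a i<..<b i}) I \<and> (\<Sum>i\<in>I. b i - a i) < min \<delta> \<eta>"
    have "norm (f (b i) * g (b i) - f (a i) * g (a i)) \<le>
        C * norm (f (b i) - f (a i)) + B * norm (g (b i) - g (a i))" if "i \<in> I" for i
    proof -
      have "f (b i) * g (b i) - f (a i) * g (a i) =
          (f (b i) - f (a i)) * g (b i) + f (a i) * (g (b i) - g (a i))"
        by (simp add: algebra_simps)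
      also have "norm \<dots> \<le> norm (f (b i) - f (a i)) * norm (g (b i)) + norm (f (a i)) * norm (g (b i) - g (a i))"
        by (intro norm_triangle_le add_mono norm_mult_ineq)
      also have "\<dots> \<le> norm (f (b i) - f (a i)) * C + B * norm (g (b i) - g (a i))"
        using * that by (intro add_mono mult_left_mono mult_right_mono B C) force+
      finally show ?thesis by (simp add: mult.commute)
    qed
    then have "(\<Sum>i\<in>I. norm (f (b i) * g (b i) - f (a i) * g (a i))) \<le>
        (\<Sum>i\<in>I. C * norm (f (b i) - f (a i)) + B * norm (g (b i) - g (a i)))"
      by (rule sum_mono)
    also have "\<dots> = C * (\<Sum>i\<in>I. norm (f (b i) - f (a i))) + B * (\<Sum>i\<in>I. norm (g (b i) - g (a i)))"
      by (simp add: sum.distrib sum_distrib_left)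
    also have "\<dots> < C * (\<epsilon> / (2 * C)) + B * (\<epsilon> / (2 * B))"
      using * B C by (intro add_strict_mono mult_strict_left_mono \<delta>(2) \<eta>(2)) auto
    also have "\<dots> = \<epsilon>"
      using B C by simp
    finally show "(\<Sum>i\<in>I. norm (f (b i) * g (b i) - f (a i) * g (a i))) < \<epsilon>" .
  qed (use \<delta> \<eta> in auto)
qed

lemma abs_continuous_on_interval_lipschitz:
  fixes f :: "real \<Rightarrow> 'a::real_normed_vector"
  assumes "L-lipschitz_on {u..v} f"
  shows "abs_continuous_on_interval u v f"
  unfolding abs_continuous_on_interval_def
proof (intro allI impI)
  fix \<epsilon> :: real
  assume "0 < \<epsilon>"
  have "0 \<le> L"
    using assms by (rule lipschitz_on_nonneg)
  show "\<exists>\<delta>>0. \<forall>(I::nat set) a b. finite I \<and> (\<forall>i\<in>I. u \<le> a i \<and> a i \<le> b i \<and> b i \<le> v) \<and>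
      disjoint_family_on (\<lambda>i. {a i<..<b i}) I \<and> (\<Sum>i\<in>I. b i - a i) < \<delta> \<longrightarrow>
      (\<Sum>i\<in>I. norm (f (b i) - f (a i))) < \<epsilon>"
  \<comment> \<open>Dividing by L + 1 covers L = 0 and makes the final inequality strict.\<close>
  proof (intro exI[of _ "\<epsilon> / (L + 1)"] conjI allI impI)
    fix I :: "nat set" and a b
    assume *: "finite I \<and> (\<forall>i\<in>I. u \<le> a i \<and> a i \<le> b i \<and> b i \<le> v) \<and>
      disjoint_family_on (\<lambda>i. {a i<..<b i}) I \<and> (\<Sum>i\<in>I. b i - a i) < \<epsilon> / (L + 1)"
    have "norm (f (b i) - f (a i)) \<le> L * (b i - a i)" if "i \<in> I" for i
      using lipschitz_onD[OF assms, of "b i" "a i"] * that by (force simp: dist_norm)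
    then have "(\<Sum>i\<in>I. norm (f (b i) - f (a i))) \<le> L * (\<Sum>i\<in>I. b i - a i)"
      by (simp add: sum_distrib_left sum_mono)
    also have "\<dots> \<le> L * (\<epsilon> / (L + 1))"
      using * \<open>0 \<le> L\<close> by (intro mult_left_mono) auto
    also have "\<dots> < \<epsilon>"
      using \<open>0 \<le> L\<close> \<open>0 < \<epsilon>\<close> by (simp add: field_simps)
    finally show "(\<Sum>i\<in>I. norm (f (b i) - f (a i))) < \<epsilon>" .
  qed (use \<open>0 < \<epsilon>\<close> \<open>0 \<le> L\<close> in auto)
qed

section \<open>The fundamental theorem of calculus for absolutely continuous functions\<close>

lemma has_integral_abs_continuous_on_interval:
  fixes f :: "real \<Rightarrow> 'a::banach"
  assumes "a \<le> b" and ac: "abs_continuous_on_interval a b f" and N: "negligible N"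
    and deriv: "\<And>x. x \<in> {a..b} - N \<Longrightarrow> (f has_vector_derivative f' x) (at x within {a..b})"
  shows "(f' has_integral (f b - f a)) {a..b}"
proof (rule has_integral_spike[OF N])
  \<comment> \<open>Tags in \<open>N\<close> contribute little by absolute continuity, the others by differentiability;
    no differentiation theorem for the Lebesgue integral is needed.\<close>
  define g where "g x = (if x \<in> N then 0 else f' x)" for x
  show "f' x = g x" if "x \<in> {a..b} - N" for x
    using that by (simp add: g_def)
  show "(g has_integral f b - f a) {a..b}"
    unfolding has_integral_real
  proof (intro allI impI)
    fix e :: real
    assume "0 < e"
    \<comment> \<open>Over the whole division the regular tags cost at most
      \<open>e' * (b - a)\<close>; the summand 1 covers a = b and keeps the bound below e/2
      strict.\<close>
    define e' where "e' = e / (2 * (b - a + 1))"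
    have "0 < e'"
      using \<open>a \<le> b\<close> \<open>0 < e\<close> by (simp add: e'_def)
    then have "\<exists>d>0. \<forall>y\<in>{a..b}. norm (y - x) < d \<longrightarrow>
        norm (f y - f x - (y - x) *\<^sub>R f' x) \<le> e' * norm (y - x)" if "x \<in> {a..b} - N" for x
      using deriv[OF that] unfolding has_vector_derivative_def has_derivative_within_alt by blast
    then obtain d where d: "\<And>x. x \<in> {a..b} - N \<Longrightarrow> 0 < d x"
      "\<And>x y. x \<in> {a..b} - N \<Longrightarrow> y \<in> {a..b} \<Longrightarrow> norm (y - x) < d x \<Longrightarrow>
        norm (f y - f x - (y - x) *\<^sub>R f' x) \<le> e' * norm (y - x)"
      by metis
    have "0 < e / 2"
      using \<open>0 < e\<close> by simp
    from ac this obtain \<delta> where \<delta>: "0 < \<delta>"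
      "\<And>(I::nat set) l r. finite I \<Longrightarrow> (\<And>i. i \<in> I \<Longrightarrow> a \<le> l i \<and> l i \<le> r i \<and> r i \<le> b) \<Longrightarrow>
         disjoint_family_on (\<lambda>i. {l i<..<r i}) I \<Longrightarrow> (\<Sum>i\<in>I. r i - l i) < \<delta> \<Longrightarrow>
         (\<Sum>i\<in>I. norm (f (r i) - f (l i))) < e / 2"
      by (rule abs_continuous_on_intervalD) blast
    \<comment> \<open>The null set N is enclosed in an open U of measure below \<delta>, so that
      absolute continuity controls disjoint intervals contained in U.\<close>
    have Nl: "N \<in> lmeasurable" "measure lebesgue N = 0"
      using N by (auto simp: negligible_iff_measure)
    then obtain U where U: "open U" "N \<subseteq> U" "U - N \<in> lmeasurable" "emeasure lebesgue (U - N) < ennreal \<delta>"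
      using sets_lebesgue_outer_open[OF _ \<delta>(1), of N] by blast
    have Um: "U \<in> lmeasurable"
      using U(2,3) Nl(1) by (metis Diff_partition fmeasurable.Un)
    have "emeasure lebesgue U = emeasure lebesgue (U - N)"
      using N Um by (intro emeasure_Diff_null_set[symmetric])
        (auto simp: negligible_iff_null_sets fmeasurable_def)
    then have "ennreal (measure lebesgue U) < ennreal \<delta>"
      using U(4) Um by (metis emeasure_eq_measure2)
    then have mU: "measure lebesgue U < \<delta>"
      by (simp add: ennreal_less_iff)
    \<comment> \<open>A tag in N forces its interval into U, any other tag in [a,b] keeps it where
      the linear approximation holds; the last branch completes the gauge to all reals.\<close>
    define \<gamma> where "\<gamma> x = (if x \<in> N then U else if x \<in> {a..b} then ball x (d x) else UNIV)" for x
    have "gauge \<gamma>"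
      using U d(1) by (auto simp: gauge_def \<gamma>_def)
    moreover have "norm ((\<Sum>(x,K)\<in>p. content K *\<^sub>R g x) - (f b - f a)) < e"
      if p: "p tagged_division_of {a..b}" "\<gamma> fine p" for p
    proof -
      have fin: "finite p"
        using p(1) by auto
      have K: "Inf K \<le> x \<and> x \<le> Sup K \<and> a \<le> Inf K \<and> Sup K \<le> b \<and> K = {Inf K..Sup K} \<and>
          content K = Sup K - Inf K \<and> K \<subseteq> \<gamma> x" if xK: "(x, K) \<in> p" for x K
      proof -
        obtain l r where lr: "K = cbox l r" "x \<in> K" "K \<subseteq> {a..b}"
          using tagged_division_ofD(2-4)[OF p(1) xK] by blast
        then have "l \<le> r" by auto
        with lr show ?thesis
          using p(2) xK by (auto simp: fine_def)
      qed
      \<comment> \<open>The error of one tagged interval. By telescoping, these errors add up to the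
        Riemann sum minus \<open>f b - f a\<close>.\<close>
      define R where "R z = (case z of (x, K) \<Rightarrow> content K *\<^sub>R g x - (f (Sup K) - f (Inf K)))"
        for z :: "real \<times> real set"
      define pN where "pN = {z \<in> p. fst z \<in> N}"
      have "norm (\<Sum>z\<in>p - pN. R z) \<le> (\<Sum>z\<in>p - pN. e' * content (snd z))"
      proof (rule sum_norm_le)
        fix z assume z: "z \<in> p - pN"
        obtain x K where zx: "z = (x, K)" by force
        have xK: "(x, K) \<in> p" "x \<notin> N" 
          using z zx by (auto simp: pN_def)
        note KK = K[OF xK(1)]
        let ?l = "Inf K" and ?r = "Sup K"
        have x: "x \<in> {a..b} - N"
          using KK xK(2) by auto
        have sub: "K \<subseteq> ball x (d x)" using KK x by (auto simp: \<gamma>_def)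
        have "?l \<in> K" "?r \<in> K"
          by (subst KK[THEN conjunct2, THEN conjunct2, THEN conjunct2, THEN conjunct2, THEN conjunct1], use KK in auto)+
        with sub have near: "norm (?l - x) < d x" "norm (?r - x) < d x"
          by (auto simp: dist_norm norm_minus_commute)
        \<comment> \<open>The increment is split at the tag; since the tag lies between the
          endpoints, the two error terms add up to \<open>e'\<close> times the length.\<close>
        have "R z = (f ?l - f x - (?l - x) *\<^sub>R f' x) - (f ?r - f x - (?r - x) *\<^sub>R f' x)"
          using xK(2) KK[THEN conjunct2, THEN conjunct2, THEN conjunct2, THEN conjunct2, THEN conjunct2, THEN conjunct1]
          by (simp add: R_def zx g_def scaleR_diff_left)
        also have "norm \<dots> \<le> norm (f ?l - f x - (?l - x) *\<^sub>R f' x) + norm (f ?r - f x - (?r - x) *\<^sub>R f' x)"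
          by (rule norm_triangle_ineq4)
        also have "\<dots> \<le> e' * norm (?l - x) + e' * norm (?r - x)"
          using KK near x by (intro add_mono d(2)) auto
        also have "\<dots> = e' * content K"
          using KK by (simp flip: distrib_left)
        finally show "norm (R z) \<le> e' * content (snd z)"
          by (simp add: zx)
      qed
      also have "\<dots> \<le> (\<Sum>z\<in>p. e' * content (snd z))"
        using \<open>0 < e'\<close> fin by (intro sum_mono2) auto
      also have "\<dots> = e' * (b - a)"
        using additive_content_tagged_division[of p a b] p(1) \<open>a \<le> b\<close>
        by (simp add: sum_distrib_left[symmetric] split_def)
      also have "\<dots> < e / 2"
        using \<open>a \<le> b\<close> \<open>0 < e\<close> by (simp add: e'_def field_simps)
      finally have regular: "norm (\<Sum>z\<in>p - pN. R z) < e / 2" .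
      have "finite pN"
        using fin by (simp add: pN_def)
      \<comment> \<open>Absolute continuity is phrased for families indexed by naturals, so the
        intervals with tags in N are enumerated.\<close>
      then obtain h where h: "bij_betw h {0..<card pN} pN"
        using ex_bij_betw_nat_finite by blast
      define l r where "l i = Inf (snd (h i))" and "r i = Sup (snd (h i))" for i
      have hp: "h i \<in> p" "fst (h i) \<in> N" if "i < card pN" for i
        using bij_betwE[OF h] that by (auto simp: pN_def)
      have Kh: "a \<le> l i \<and> l i \<le> r i \<and> r i \<le> b \<and> snd (h i) = {l i..r i} \<and> {l i..r i} \<subseteq> U" 
        if "i < card pN" for i
      proof -
        have "(fst (h i), snd (h i)) \<in> p" using hp[OF that] by simp
        from K[OF this] hp[OF that] show ?thesis
          by (auto simp: l_def r_def \<gamma>_def)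
      qed
      have disj: "disjoint_family_on (\<lambda>i. {l i<..<r i}) {0..<card pN}"
        unfolding disjoint_family_on_def
      proof (intro ballI impI)
        fix i j assume ij: "i \<in> {0..<card pN}" "j \<in> {0..<card pN}" "i \<noteq> j"
        then have "h i \<noteq> h j"
          using h by (metis bij_betw_imp_inj_on inj_onD)
        then have "interior (snd (h i)) \<inter> interior (snd (h j)) = {}"
          using tagged_division_ofD(5)[OF p(1), of "fst (h i)" "snd (h i)" "fst (h j)" "snd (h j)"] hp ij
          by (auto simp: prod_eq_iff)
        then show "{l i<..<r i} \<inter> {l j<..<r j} = {}"
          using Kh ij by auto
      qed
      \<comment> \<open>Disjoint intervals inside U have total length at most the measure of U,
        hence below \<delta>.\<close>
      have "(\<Sum>i\<in>{0..<card pN}. r i - l i) = (\<Sum>i\<in>{0..<card pN}. measure lebesgue {l i<..<r i})"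
        using Kh by (intro sum.cong) auto
      also have "\<dots> = measure lebesgue (\<Union>i\<in>{0..<card pN}. {l i<..<r i})"
        using disj Kh by (intro measure_finite_Union[symmetric]) auto
      also have "\<dots> \<le> measure lebesgue U"
      proof (rule measure_mono_fmeasurable[OF _ _ Um])
        show "(\<Union>i\<in>{0..<card pN}. {l i<..<r i}) \<subseteq> U"
          using Kh by (force simp: subset_iff)
      qed auto
      also note mU
      finally have "(\<Sum>i\<in>{0..<card pN}. norm (f (r i) - f (l i))) < e / 2"
        using Kh disj by (intro \<delta>(2)) auto
      \<comment> \<open>On N the integrand was set to 0, so the error there is just the increment of
        f.\<close>
      also have "(\<Sum>i\<in>{0..<card pN}. norm (f (r i) - f (l i))) = (\<Sum>z\<in>pN. norm (R z))"
        unfolding sum.reindex_bij_betw[OF h, of "\<lambda>z. norm (R z)", symmetric]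
        using hp by (intro sum.cong) (auto simp: R_def l_def r_def split_def g_def norm_minus_commute)
      finally have singular: "norm (\<Sum>z\<in>pN. R z) < e / 2"
        using norm_sum[of R pN] by linarith
      have "(\<Sum>(x,K)\<in>p. content K *\<^sub>R g x) - (f b - f a) = (\<Sum>z\<in>p. R z)"
        using additive_tagged_division_1[OF \<open>a \<le> b\<close> p(1), of f]
        by (simp add: R_def split_def sum_subtractf)
      also have "\<dots> = (\<Sum>z\<in>p - pN. R z) + (\<Sum>z\<in>pN. R z)"
        using fin by (intro sum.subset_diff) (auto simp: pN_def)
      finally show ?thesis
        using regular singular norm_triangle_ineq[of "\<Sum>z\<in>p - pN. R z" "\<Sum>z\<in>pN. R z"] by simp
    qed
    ultimately show "\<exists>\<gamma>. gauge \<gamma> \<and> (\<forall>\<D>. \<D> tagged_division_of {a..b} \<and> \<gamma> fine \<D> \<longrightarrow>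
        norm ((\<Sum>(x, k)\<in>\<D>. content k *\<^sub>R g x) - (f b - f a)) < e)"
      by (intro exI[of _ \<gamma>]) simp
  qed
qed

section \<open>Integrals over intervals\<close>

lemma continuous_on_set_lebesgue_integral_Icc:
  fixes f :: "real \<Rightarrow> 'a::euclidean_space"
  assumes "set_integrable lebesgue {a..b} f"
  shows "continuous_on {a..b} (\<lambda>x. LINT t:{a..x}|lebesgue. f t)"
proof -
  have "(LINT t:{a..x}|lebesgue. f t) = integral {a..x} f" if "x \<in> {a..b}" for x
    using that by (intro set_lebesgue_integral_eq_integral(2) set_integrable_subset[OF assms]) auto
  moreover have "continuous_on {a..b} (\<lambda>x. integral {a..x} f)"
    by (intro indefinite_integral_continuous_1 set_lebesgue_integral_eq_integral(1) assms)
  ultimately show ?thesis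
    by (subst continuous_on_cong[OF refl]) auto
qed

lemma set_integrable_mult_continuous_on:
  fixes f g :: "real \<Rightarrow> 'a::{real_normed_algebra, euclidean_space}"
  assumes "set_integrable lebesgue {a..b} f" "continuous_on {a..b} g"
  shows "set_integrable lebesgue {a..b} (\<lambda>x. f x * g x)"
proof -
  \<comment> \<open>The product rule applied below takes the bounded measurable factor first, so the
    bilinear map swaps its arguments.\<close>
  have "bilinear (\<lambda>x y. y * x :: 'a)"
    by (simp add: bilinear_def linear_iff algebra_simps)
  then show ?thesis
    using assms by (intro absolutely_integrable_bounded_measurable_product[of "\<lambda>x y. y * x"]
        continuous_imp_measurable_on_sets_lebesgue compact_imp_bounded compact_continuous_image) auto
qed

lemma set_integrable_Icc_le:
  fixes f :: "real \<Rightarrow> 'a::{banach, second_countable_topology}"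
  shows "set_integrable lebesgue {a..b} f \<Longrightarrow> x \<le> b \<Longrightarrow> set_integrable lebesgue {a..x} f"
  by (rule set_integrable_subset) auto

lemma set_integrable_Icc_le_mult_continuous_on:
  fixes f g :: "real \<Rightarrow> 'a::{real_normed_algebra, euclidean_space}"
  assumes "set_integrable lebesgue {a..b} f" "continuous_on {a..b} g" "x \<le> b"
  shows "set_integrable lebesgue {a..x} (\<lambda>x. f x * g x)"
  by (rule set_integrable_Icc_le[OF set_integrable_mult_continuous_on[OF assms(1,2)] assms(3)])

lemma set_lebesgue_integral_Icc_split:
  fixes f :: "real \<Rightarrow> 'a::euclidean_space"
  assumes "set_integrable lebesgue {a..b} f" "a \<le> s" "s \<le> b"
  shows "(LINT t:{s..b}|lebesgue. f t) = (LINT t:{a..b}|lebesgue. f t) - (LINT t:{a..s}|lebesgue. f t)"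
proof -
  have *: "set_integrable lebesgue {a..s} f" "set_integrable lebesgue {s..b} f"
    using assms by (auto intro: set_integrable_subset)
  show ?thesis
    using Henstock_Kurzweil_Integration.integral_combine[OF assms(2,3) set_lebesgue_integral_eq_integral(1)[OF assms(1)]]
    by (simp add: set_lebesgue_integral_eq_integral(2) * assms(1) algebra_simps)
qed

lemma integral_lebesgue_on_Icc:
  fixes f :: "real \<Rightarrow> 'a::{banach, second_countable_topology}"
  shows "integral\<^sup>L (lebesgue_on {a..b}) f = (LINT t:{a..b}|lebesgue. f t)"
  by (simp add: integral_restrict_space set_lebesgue_integral_def)

lemma integrable_lebesgue_on_Icc_iff:
  fixes f :: "real \<Rightarrow> 'a::{banach, second_countable_topology}"
  shows "integrable (lebesgue_on {a..b}) f \<longleftrightarrow> set_integrable lebesgue {a..b} f"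
  by (simp add: integrable_restrict_space set_integrable_def)

section \<open>Iterated integrals over a triangle: Fubini, integration by parts, powers of a
  primitive\<close>

lemma set_lebesgue_integral_Icc_swap:
  fixes f g :: "real \<Rightarrow> 'a::{real_normed_field, euclidean_space}"
  assumes f: "set_integrable lebesgue {a..b} f" and g: "set_integrable lebesgue {a..b} g"
  shows "(LINT t:{a..b}|lebesgue. f t * (LINT s:{a..t}|lebesgue. g s)) =
         (LINT s:{a..b}|lebesgue. g s * (LINT t:{s..b}|lebesgue. f t))"
proof -
  define M where "M = lebesgue_on {a..b}"
  interpret finite_measure M
    unfolding M_def by (rule finite_measure_lebesgue_on) simp
  interpret P: pair_sigma_finite M M ..
  have fM: "integrable M f" and gM: "integrable M g"
    using f g by (simp_all add: M_def integrable_lebesgue_on_Icc_iff)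
  note [measurable] = borel_measurable_integrable[OF fM] borel_measurable_integrable[OF gM]
  have [measurable]: "(\<lambda>x. x) \<in> borel_measurable M"
    unfolding M_def by (intro measurable_restrict_space1 measurable_completion) simp
  have "integrable (M \<Otimes>\<^sub>M M) (\<lambda>z. f (fst z) * g (snd z))"
  proof (rule P.Fubini_integrable)
    show "integrable M (\<lambda>x. LINT y|M. norm (f (fst (x, y)) * g (snd (x, y))))"
      using fM by (simp add: norm_mult)
  qed (use gM in auto)
  \<comment> \<open>Cutting the square down to the triangle s <= t by an indicator keeps
    integrability and gives both iterated integrals the same integrand.\<close>
  then have "integrable (M \<Otimes>\<^sub>M M) (\<lambda>z. indicator {z \<in> space (M \<Otimes>\<^sub>M M). snd z \<le> fst z} z *\<^sub>R (f (fst z) * g (snd z)))"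
    by (intro integrable_mult_indicator) measurable
  then have "integrable (M \<Otimes>\<^sub>M M) (\<lambda>(t, s). (if s \<le> t then f t * g s else 0))"
    by (rule Bochner_Integration.integrable_cong[THEN iffD1, rotated -1])
      (auto simp: indicator_def space_pair_measure)
  from P.Fubini_integral[OF this]
  have "(LINT s|M. (LINT t|M. (if s \<le> t then f t * g s else 0))) =
        (LINT t|M. (LINT s|M. (if s \<le> t then f t * g s else 0)))" .
  also have "(LINT t|M. (LINT s|M. (if s \<le> t then f t * g s else 0))) =
      (LINT t:{a..b}|lebesgue. f t * (LINT s:{a..t}|lebesgue. g s))"
    unfolding M_def integral_lebesgue_on_Icc
  proof (intro set_lebesgue_integral_cong)
    show "\<forall>t. t \<in> {a..b} \<longrightarrow> (LINT s:{a..b}|lebesgue. (if s \<le> t then f t * g s else 0)) =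
        f t * (LINT s:{a..t}|lebesgue. g s)"
    proof (intro allI impI)
      fix t assume "t \<in> {a..b}"
      then have "(LINT s:{a..b}|lebesgue. (if s \<le> t then f t * g s else 0)) =
          (LINT s:{a..t}|lebesgue. f t * g s)"
        unfolding set_lebesgue_integral_def
        by (intro Bochner_Integration.integral_cong) (auto simp: indicator_def)
      then show "(LINT s:{a..b}|lebesgue. (if s \<le> t then f t * g s else 0)) =
          f t * (LINT s:{a..t}|lebesgue. g s)" by simp
    qed
  qed simp
  also have "(LINT s|M. (LINT t|M. (if s \<le> t then f t * g s else 0))) =
      (LINT s:{a..b}|lebesgue. g s * (LINT t:{s..b}|lebesgue. f t))"
    unfolding M_def integral_lebesgue_on_Icc
  proof (intro set_lebesgue_integral_cong)
    show "\<forall>s. s \<in> {a..b} \<longrightarrow> (LINT t:{a..b}|lebesgue. (if s \<le> t then f t * g s else 0)) =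
        g s * (LINT t:{s..b}|lebesgue. f t)"
    proof (intro allI impI)
      fix s assume "s \<in> {a..b}"
      then have "(LINT t:{a..b}|lebesgue. (if s \<le> t then f t * g s else 0)) =
          (LINT t:{s..b}|lebesgue. g s * f t)"
        unfolding set_lebesgue_integral_def
        by (intro Bochner_Integration.integral_cong) (auto simp: indicator_def)
      then show "(LINT t:{a..b}|lebesgue. (if s \<le> t then f t * g s else 0)) =
          g s * (LINT t:{s..b}|lebesgue. f t)" by simp
    qed
  qed simp
  finally show ?thesis ..
qed

text \<open>Swap the order of integration and write the integral over [s,b] as the one over [a,b]
  minus the one over [a,s]. This argument asks only for integrability, so it covers \<alpha> and
  \<beta>.\<close>

lemma set_lebesgue_integral_Icc_by_parts:
  fixes f g :: "real \<Rightarrow> 'a::{real_normed_field, euclidean_space}"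
  assumes f: "set_integrable lebesgue {a..b} f" and g: "set_integrable lebesgue {a..b} g"
  shows "(LINT t:{a..b}|lebesgue. f t * (LINT s:{a..t}|lebesgue. g s)) =
         (LINT t:{a..b}|lebesgue. f t) * (LINT t:{a..b}|lebesgue. g t) -
         (LINT s:{a..b}|lebesgue. g s * (LINT t:{a..s}|lebesgue. f t))"
proof -
  have "(LINT t:{a..b}|lebesgue. f t * (LINT s:{a..t}|lebesgue. g s)) =
      (LINT s:{a..b}|lebesgue. g s * (LINT t:{a..b}|lebesgue. f t) - g s * (LINT t:{a..s}|lebesgue. f t))"
    unfolding set_lebesgue_integral_Icc_swap[OF f g]
    by (intro set_lebesgue_integral_cong allI impI)
      (simp, subst set_lebesgue_integral_Icc_split[OF f], auto simp: right_diff_distrib)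
  also have "\<dots> = (LINT s:{a..b}|lebesgue. g s * (LINT t:{a..b}|lebesgue. f t)) -
      (LINT s:{a..b}|lebesgue. g s * (LINT t:{a..s}|lebesgue. f t))"
    by (intro set_integral_diff(2) set_integrable_mult_continuous_on g
        continuous_on_set_lebesgue_integral_Icc f continuous_intros)
  finally show ?thesis
    by (simp add: mult.commute)
qed

text \<open>The chain rule for powers of a primitive F of a merely integrable f. Integration by
  parts makes the unknown integral reappear on the right, and it is solved for.\<close>

lemma set_lebesgue_integral_Icc_power:
  fixes f :: "real \<Rightarrow> 'a::{real_normed_field, euclidean_space}"
  assumes "set_integrable lebesgue {a..b} f"
  shows "(LINT t:{a..b}|lebesgue. f t * (LINT s:{a..t}|lebesgue. f s) ^ n) =
         (LINT t:{a..b}|lebesgue. f t) ^ Suc n / of_nat (Suc n)"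
  using assms
proof (induction n arbitrary: b)
  case (Suc n)
  define F where "F t = (LINT s:{a..t}|lebesgue. f s)" for t
  define J where "J = (LINT t:{a..b}|lebesgue. f t * F t ^ Suc n)"
  have int: "set_integrable lebesgue {a..b} (\<lambda>s. f s * F s ^ n)"
    unfolding F_def by (intro set_integrable_mult_continuous_on Suc.prems continuous_intros
        continuous_on_set_lebesgue_integral_Icc)
  have IH: "(LINT s:{a..t}|lebesgue. of_nat (Suc n) * (f s * F s ^ n)) = F t ^ Suc n" if "t \<le> b" for t
  proof -
    have "set_integrable lebesgue {a..t} f"
      by (rule set_integrable_subset[OF Suc.prems]) (use that in auto)
    from Suc.IH[OF this] show ?thesis
      by (simp add: F_def del: of_nat_Suc)
  qed
  \<comment> \<open>\<open>F t ^ Suc n\<close> is replaced by its integral representation from the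
    induction hypothesis, so that integration by parts applies.\<close>
  have "J = (LINT t:{a..b}|lebesgue. f t * (LINT s:{a..t}|lebesgue. of_nat (Suc n) * (f s * F s ^ n)))"
    unfolding J_def by (intro set_lebesgue_integral_cong) (use IH in auto)
  also have "\<dots> = F b * F b ^ Suc n - (LINT s:{a..b}|lebesgue. of_nat (Suc n) * (f s * F s ^ n) * F s)"
    using set_lebesgue_integral_Icc_by_parts[OF Suc.prems set_integrable_mult_right[OF int, of "of_nat (Suc n)"]]
      IH[OF order_refl] unfolding F_def by metis
  also have "(LINT s:{a..b}|lebesgue. of_nat (Suc n) * (f s * F s ^ n) * F s) = of_nat (Suc n) * J"
    unfolding J_def set_integral_mult_right[symmetric] by (simp only: power_Suc2 ac_simps)
  finally have "of_nat (Suc (Suc n)) * J = F b ^ Suc (Suc n)"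
    by (simp add: algebra_simps)
  then have "J = F b ^ Suc (Suc n) / of_nat (Suc (Suc n))"
    by (metis nonzero_mult_div_cancel_left of_nat_neq_0)
  then show ?case
    by (simp add: J_def F_def)
qed simp

section \<open>Integral inequalities: domination, Gronwall, Cauchy-Schwarz\<close>

text \<open>If f is not integrable over B, its integral is 0 by convention and nonnegativity of g
  gives the bound; estimates can thus be made without integrability proofs for f.\<close>

lemma norm_set_lebesgue_integral_le:
  fixes f :: "'a \<Rightarrow> 'b::{banach, second_countable_topology}"
  assumes "set_integrable M A g" "B \<in> sets M" "B \<subseteq> A" "A \<in> sets M"
    and "\<And>x. x \<in> A \<Longrightarrow> 0 \<le> g x" "\<And>x. x \<in> B \<Longrightarrow> norm (f x) \<le> g x"
  shows "norm (LINT x:B|M. f x) \<le> (LINT x:A|M. g x)"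
proof (cases "set_integrable M B f")
  case True
  then have "integrable M (\<lambda>x. norm (indicator B x *\<^sub>R f x))"
    unfolding set_integrable_def by (rule integrable_norm)
  then show ?thesis
    using assms unfolding set_lebesgue_integral_def set_integrable_def
    by (intro order_trans[OF integral_norm_bound Bochner_Integration.integral_mono])
      (auto simp: indicator_def)
next
  case False
  then show ?thesis
    using assms unfolding set_lebesgue_integral_def set_integrable_def
    by (subst not_integrable_integral_eq) (auto intro!: Bochner_Integration.integral_nonneg simp: indicator_def)
qed

text \<open>In place of a differential inequality, the hypothesis is iterated n times. By the power
  rule for primitives this produces partial sums of the exponential series and a remainder that
  tends to 0.\<close>

lemma gronwall_set_lebesgue_integral:
  fixes \<phi> \<psi> :: "real \<Rightarrow> real"
  assumes \<phi>: "set_integrable lebesgue {a..b} \<phi>" "\<And>t. t \<in> {a..b} \<Longrightarrow> 0 \<le> \<phi> t"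
    and \<psi>: "continuous_on {a..b} \<psi>"
    and le: "\<And>x. x \<in> {a..b} \<Longrightarrow> \<psi> x \<le> \<epsilon> + (LINT t:{a..x}|lebesgue. \<phi> t * \<psi> t)"
    and x: "x \<in> {a..b}"
  shows "\<psi> x \<le> \<epsilon> * exp (LINT t:{a..x}|lebesgue. \<phi> t)"
proof -
  define \<Phi> where "\<Phi> x = (LINT t:{a..x}|lebesgue. \<phi> t)" for x
  obtain B where B: "0 < B" "\<And>x. x \<in> {a..b} \<Longrightarrow> norm (\<psi> x) \<le> B"
    using continuous_on_Icc_norm_bound[OF \<psi>] by blast
  have sub: "set_integrable lebesgue {a..x} \<phi>" if "x \<in> {a..b}" for x
    using that by (intro set_integrable_subset[OF \<phi>(1)]) auto
  have power: "(LINT t:{a..x}|lebesgue. \<phi> t * \<Phi> t ^ k) = \<Phi> x ^ Suc k / Suc k" if "x \<in> {a..b}" for x k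
    using set_lebesgue_integral_Icc_power[OF sub[OF that]] by (simp add: \<Phi>_def)
  have int: "set_integrable lebesgue {a..x} (\<lambda>t. \<phi> t * \<Phi> t ^ k)" if "x \<in> {a..b}" for x k
    unfolding \<Phi>_def by (intro set_integrable_mult_continuous_on continuous_intros
        continuous_on_set_lebesgue_integral_Icc sub that)
  \<comment> \<open>For n = 0 the sum is empty and the remainder is the bound B of \<psi>; each
    substitution into the hypothesis raises every power of \<Phi> by one.\<close>
  have iter: "\<psi> x \<le> \<epsilon> * (\<Sum>k<n. \<Phi> x ^ k /\<^sub>R fact k) + B * (\<Phi> x ^ n /\<^sub>R fact n)" if "x \<in> {a..b}" for x n
    using that
  proof (induction n arbitrary: x)
    case 0
    then show ?case using B(2)[of x] by simp
  next
    case (Suc n)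
    have int': "set_integrable lebesgue {a..x} (\<lambda>t. \<phi> t * (c * (\<Phi> t ^ k /\<^sub>R fact k)))" for c k
      using set_integrable_mult_right[OF int[OF Suc.prems, of k], of "c / fact k"]
      by (simp add: divide_inverse ac_simps)
    have val: "(LINT t:{a..x}|lebesgue. \<phi> t * (c * (\<Phi> t ^ k /\<^sub>R fact k))) = c * (\<Phi> x ^ Suc k /\<^sub>R fact (Suc k))" for c k
    proof -
      have "(LINT t:{a..x}|lebesgue. \<phi> t * (c * (\<Phi> t ^ k /\<^sub>R fact k))) =
          (c / fact k) * (LINT t:{a..x}|lebesgue. \<phi> t * \<Phi> t ^ k)"
        by (subst set_integral_mult_right[symmetric]) (simp add: divide_inverse ac_simps)
      then show ?thesis
        using power[OF Suc.prems, of k] by (simp add: divide_inverse ac_simps)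
    qed
    have sumint: "set_integrable lebesgue {a..x} (\<lambda>t. \<Sum>k<n. \<phi> t * (\<epsilon> * (\<Phi> t ^ k /\<^sub>R fact k)))"
      using int' unfolding set_integrable_def scaleR_sum_right
      by (intro Bochner_Integration.integrable_sum) blast
    have "\<psi> x \<le> \<epsilon> + (LINT t:{a..x}|lebesgue. \<phi> t * \<psi> t)"
      by (rule le) fact
    also have "(LINT t:{a..x}|lebesgue. \<phi> t * \<psi> t) \<le>
        (LINT t:{a..x}|lebesgue. (\<Sum>k<n. \<phi> t * (\<epsilon> * (\<Phi> t ^ k /\<^sub>R fact k))) + \<phi> t * (B * (\<Phi> t ^ n /\<^sub>R fact n)))"
    proof (rule set_integral_mono)
      show "set_integrable lebesgue {a..x} (\<lambda>t. \<phi> t * \<psi> t)"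
        using Suc.prems by (intro set_integrable_mult_continuous_on sub continuous_on_subset[OF \<psi>]) auto
      show "\<phi> t * \<psi> t \<le> (\<Sum>k<n. \<phi> t * (\<epsilon> * (\<Phi> t ^ k /\<^sub>R fact k))) + \<phi> t * (B * (\<Phi> t ^ n /\<^sub>R fact n))"
        if "t \<in> {a..x}" for t
        using mult_left_mono[OF Suc.IH[of t] \<phi>(2)[of t]] that Suc.prems
        by (simp add: sum_distrib_left distrib_left)
    qed (intro set_integral_add sumint int')
    also have "\<dots> = (LINT t:{a..x}|lebesgue. (\<Sum>k<n. \<phi> t * (\<epsilon> * (\<Phi> t ^ k /\<^sub>R fact k)))) +
        (LINT t:{a..x}|lebesgue. \<phi> t * (B * (\<Phi> t ^ n /\<^sub>R fact n)))"
      by (intro set_integral_add(2) sumint int')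
    also have "(LINT t:{a..x}|lebesgue. (\<Sum>k<n. \<phi> t * (\<epsilon> * (\<Phi> t ^ k /\<^sub>R fact k)))) =
        (\<Sum>k<n. (LINT t:{a..x}|lebesgue. \<phi> t * (\<epsilon> * (\<Phi> t ^ k /\<^sub>R fact k))))"
      unfolding set_lebesgue_integral_def scaleR_sum_right
      by (rule Bochner_Integration.integral_sum) (use int' in \<open>simp add: set_integrable_def\<close>)
    finally have "\<psi> x \<le> \<epsilon> + ((\<Sum>k<n. \<epsilon> * (\<Phi> x ^ Suc k /\<^sub>R fact (Suc k))) + B * (\<Phi> x ^ Suc n /\<^sub>R fact (Suc n)))"
      unfolding val by simp
    \<comment> \<open>Index shift: the constant \<epsilon> supplies the term k = 0.\<close>
    also have "\<epsilon> + ((\<Sum>k<n. \<epsilon> * (\<Phi> x ^ Suc k /\<^sub>R fact (Suc k))) + B * (\<Phi> x ^ Suc n /\<^sub>R fact (Suc n))) =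
        \<epsilon> * (\<Sum>k<Suc n. \<Phi> x ^ k /\<^sub>R fact k) + B * (\<Phi> x ^ Suc n /\<^sub>R fact (Suc n))"
      unfolding sum.lessThan_Suc_shift by (simp add: distrib_left sum_distrib_left)
    finally show ?case .
  qed
  have sums: "(\<lambda>n. \<Phi> x ^ n /\<^sub>R fact n) sums exp (\<Phi> x)"
    by (rule exp_converges)
  have "(\<lambda>n. \<epsilon> * (\<Sum>k<n. \<Phi> x ^ k /\<^sub>R fact k) + B * (\<Phi> x ^ n /\<^sub>R fact n)) \<longlonglongrightarrow> \<epsilon> * exp (\<Phi> x) + B * 0"
    by (intro tendsto_intros sums[unfolded sums_def] summable_LIMSEQ_zero sums_summable[OF sums])
  then have "\<psi> x \<le> \<epsilon> * exp (\<Phi> x) + B * 0"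
    by (rule LIMSEQ_le_const) (use iter[OF x] in blast)
  then show ?thesis
    by (simp add: \<Phi>_def)
qed

text \<open>The integral of \<open>w t * (\<gamma> t - l)\<^sup>2\<close> is a nonnegative quadratic
  polynomial in l, and suitable values of l give the inequality.\<close>

lemma set_lebesgue_integral_weighted_Cauchy_Schwarz:
  fixes w \<gamma> :: "real \<Rightarrow> real"
  assumes w: "set_integrable lebesgue {a..b} w" "\<And>t. t \<in> {a..b} \<Longrightarrow> 0 \<le> w t"
    and \<gamma>: "continuous_on {a..b} \<gamma>"
  shows "(LINT t:{a..b}|lebesgue. w t * \<gamma> t)\<^sup>2 \<le>
         (LINT t:{a..b}|lebesgue. w t) * (LINT t:{a..b}|lebesgue. w t * (\<gamma> t)\<^sup>2)"
proof -
  let ?S = "LINT t:{a..b}|lebesgue. w t" and ?k = "LINT t:{a..b}|lebesgue. w t * \<gamma> t"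
    and ?q = "LINT t:{a..b}|lebesgue. w t * (\<gamma> t)\<^sup>2"
  have int: "set_integrable lebesgue {a..b} (\<lambda>t. w t * \<gamma> t)"
    "set_integrable lebesgue {a..b} (\<lambda>t. w t * (\<gamma> t)\<^sup>2)"
    by (intro set_integrable_mult_continuous_on w \<gamma> continuous_intros)+
  have quad: "0 \<le> ?q - 2 * l * ?k + l\<^sup>2 * ?S" for l :: real
  proof -
    have "0 \<le> (LINT t:{a..b}|lebesgue. w t * (\<gamma> t - l)\<^sup>2)"
      unfolding set_lebesgue_integral_def using w(2)
      by (intro Bochner_Integration.integral_nonneg) (auto simp: indicator_def)
    also have "\<dots> = (LINT t:{a..b}|lebesgue. w t * (\<gamma> t)\<^sup>2 - 2 * l * (w t * \<gamma> t) + l\<^sup>2 * w t)"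
      by (simp add: power2_eq_square algebra_simps)
    also have "\<dots> = ?q - 2 * l * ?k + l\<^sup>2 * ?S"
      using int w(1) by (subst set_integral_add(2) set_integral_diff(2); simp)+
    finally show ?thesis .
  qed
  have "0 \<le> ?S"
    using norm_set_lebesgue_integral_le[OF w(1), of "{}" "\<lambda>_. 0::real"] w(2) by simp
  show ?thesis
  proof (cases "?S = 0")
    case True
    have "?k = 0"
    proof (rule ccontr)
      assume "?k \<noteq> 0"
      then show False
        \<comment> \<open>When the total weight is 0 the polynomial is affine in l, and this l would
          give it the value -1.\<close>
        using quad[of "(?q + 1) / (2 * ?k)"] True by simp
    qed
    then show ?thesis using True by simp
  next
    case False
    then show ?thesis
      \<comment> \<open>The minimiser of the quadratic polynomial.\<close>
      using quad[of "?k / ?S"] \<open>0 \<le> ?S\<close>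
      by (simp add: field_simps power2_eq_square)
  qed
qed

text \<open>Variation of constants: the integrating factor \<open>exp (- c * of_real t)\<close>
  removes the term c y. It is Lipschitz on the interval, so the product with y stays absolutely
  continuous and the fundamental theorem applies off a null set.\<close>

lemma integral_equation_abs_continuous_on_interval:
  fixes y g :: "real \<Rightarrow> complex"
  assumes y: "abs_continuous_on_interval u v y"
    and g: "set_integrable lebesgue {u..v} g"
    and ae: "AE t in lebesgue_on {u..v}. (y has_vector_derivative c * y t + g t) (at t within {u..v})"
    and x: "x \<in> {u..v}"
  shows "exp (- c * of_real x) * y x =
         exp (- c * of_real u) * y u + (LINT t:{u..x}|lebesgue. exp (- c * of_real t) * g t)"
proof -
  define E where "E t = exp (- c * complex_of_real t)" for t
  have dE: "(E has_vector_derivative - c * E t) (at t within X)" for t X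
  proof -
    have "((\<lambda>z. exp (- c * z)) has_field_derivative - c * exp (- c * of_real t)) (at (of_real t))"
      by (auto intro!: derivative_eq_intros)
    then show ?thesis
      unfolding E_def by (rule has_vector_derivative_real_field)
  qed
  have cE: "continuous_on X E" for X
    unfolding E_def by (intro continuous_intros)
  obtain B where B: "0 < B" "\<And>t. t \<in> {u..v} \<Longrightarrow> norm (E t) \<le> B"
    using continuous_on_Icc_norm_bound[OF cE] by blast
  have "(norm c * B)-lipschitz_on {u..v} E"
  proof (rule bounded_derivative_imp_lipschitz)
    show "(E has_derivative (\<lambda>h. h *\<^sub>R (- c * E t))) (at t within {u..v})" for t
      using dE by (simp add: has_vector_derivative_def)
    show "onorm (\<lambda>h. h *\<^sub>R (- c * E t)) \<le> norm c * B" if "t \<in> {u..v}" for t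
    proof (rule onorm_le)
      show "norm (h *\<^sub>R (- c * E t)) \<le> norm c * B * norm h" for h
        using mult_right_mono[OF mult_left_mono[OF B(2)[OF that], of "norm c"], of "norm h"]
        by (simp add: norm_mult mult_ac)
    qed
  qed (use B in auto)
  then have ac: "abs_continuous_on_interval u v (\<lambda>t. E t * y t)"
    by (intro abs_continuous_on_interval_mult y abs_continuous_on_interval_lipschitz)
  from ae have "AE t in lebesgue. t \<in> {u..v} \<longrightarrow> (y has_vector_derivative c * y t + g t) (at t within {u..v})"
    by (simp add: AE_restrict_space_iff)
  then obtain N where N: "N \<in> null_sets lebesgue"
    "{t. \<not> (t \<in> {u..v} \<longrightarrow> (y has_vector_derivative c * y t + g t) (at t within {u..v}))} \<subseteq> N"
    unfolding completion.AE_iff_null_sets by (auto simp: eventually_ae_filter)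
  have "((\<lambda>t. E t * g t) has_integral E x * y x - E u * y u) {u..x}"
  proof (rule has_integral_abs_continuous_on_interval[where f = "\<lambda>t. E t * y t"])
    show "negligible N"
      using N by (simp add: negligible_iff_null_sets)
    show "((\<lambda>t. E t * y t) has_vector_derivative E t * g t) (at t within {u..x})" if "t \<in> {u..x} - N" for t
    proof (rule has_vector_derivative_within_subset)
      have "(y has_vector_derivative c * y t + g t) (at t within {u..v})"
        using N that x by auto
      from has_vector_derivative_mult[OF dE this]
      show "((\<lambda>t. E t * y t) has_vector_derivative E t * g t) (at t within {u..v})"
        by (simp add: algebra_simps)
    qed (use x in auto)
    show "abs_continuous_on_interval u x (\<lambda>t. E t * y t)"
      using x by (intro abs_continuous_on_interval_subset[OF ac]) auto
  qed (use x in auto)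
  moreover have "set_integrable lebesgue {u..x} (\<lambda>t. E t * g t)"
    using set_integrable_mult_continuous_on[OF set_integrable_subset[OF g] cE, of u x] x
    by (simp add: mult.commute)
  ultimately show ?thesis
    unfolding E_def[symmetric] by (simp add: set_lebesgue_integral_eq_integral(2) integral_unique)
qed

section \<open>The Volterra equation\<close>

text \<open>The parameter \<mu> is fixed here, while \<open>M\<close> can later be chosen for the
  whole half-plane at once. The constants of the final estimates contain only \<open>M\<close> and
  L^1 norms of the coefficients, which is what makes them uniform.\<close>

locale dirac_kernels =
  fixes \<sigma>\<^sub>1 \<sigma>\<^sub>2 :: "real \<Rightarrow> complex" and \<mu> :: complex and M :: real
  assumes \<sigma>\<^sub>1: "set_integrable lebesgue {0..1} \<sigma>\<^sub>1"
    and \<sigma>\<^sub>2: "set_integrable lebesgue {0..1} \<sigma>\<^sub>2"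
    and norm_exp_le: "\<And>t. t \<in> {0..1} \<Longrightarrow> cmod (exp (2 * \<i> * \<mu> * of_real t)) \<le> M"
begin

definition \<alpha> :: "real \<Rightarrow> complex" where
  "\<alpha> t = exp (- 2 * \<i> * \<mu> * of_real t) * \<sigma>\<^sub>1 t"

definition \<beta> :: "real \<Rightarrow> complex" where
  "\<beta> t = exp (2 * \<i> * \<mu> * of_real t) * \<sigma>\<^sub>2 t"

definition A :: "real \<Rightarrow> complex" where
  "A x = (LINT t:{0..x}|lebesgue. \<alpha> t)"

definition H :: "real \<Rightarrow> complex" where
  "H x = (LINT t:{0..x}|lebesgue. \<beta> t)"

definition K :: "real \<Rightarrow> complex" where
  "K x = (LINT t:{0..x}|lebesgue. \<beta> t * A t)"

definition T :: "(real \<Rightarrow> complex) \<Rightarrow> real \<Rightarrow> complex" where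
  "T f x = (LINT s:{0..x}|lebesgue. \<beta> s * (LINT t:{0..s}|lebesgue. \<alpha> t * f t))"

definition S :: real where "S = (LINT t:{0..1}|lebesgue. cmod (\<sigma>\<^sub>2 t))"

definition P :: real where "P = (LINT t:{0..1}|lebesgue. cmod (\<sigma>\<^sub>1 t))"

text \<open>The L^1 norm of \<beta> A, of first order in \<open>gamma01\<close>. It has to occur
  squared in the final bounds, where Cauchy-Schwarz trades it for \<open>q\<close>, the first
  summand of \<open>gamma_tilde\<close>.\<close>

definition k :: real where "k = (LINT t:{0..1}|lebesgue. cmod (\<sigma>\<^sub>2 t) * gamma01 \<sigma>\<^sub>1 t \<mu>)"

definition q :: real where "q = (LINT t:{0..1}|lebesgue. cmod (\<sigma>\<^sub>2 t) * (gamma01 \<sigma>\<^sub>1 t \<mu>)\<^sup>2)"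

section \<open>The operator T: continuity, linearity, integration by parts\<close>

lemma set_integrable_\<alpha>: "set_integrable lebesgue {0..1} \<alpha>"
  and set_integrable_\<beta>: "set_integrable lebesgue {0..1} \<beta>"
proof -
  show "set_integrable lebesgue {0..1} \<alpha>"
    using set_integrable_mult_continuous_on[OF \<sigma>\<^sub>1, of "\<lambda>t. exp (- 2 * \<i> * \<mu> * of_real t)"]
    by (simp add: \<alpha>_def[abs_def] mult.commute continuous_intros)
  show "set_integrable lebesgue {0..1} \<beta>"
    using set_integrable_mult_continuous_on[OF \<sigma>\<^sub>2, of "\<lambda>t. exp (2 * \<i> * \<mu> * of_real t)"]
    by (simp add: \<beta>_def[abs_def] mult.commute continuous_intros)
qed

lemmas set_integrable_01_le = set_integrable_Icc_le[where a = 0 and b = 1]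

lemmas set_integrable_01_le_mult_continuous_on =
  set_integrable_Icc_le_mult_continuous_on[where a = 0 and b = 1]

lemma continuous_on_A: "continuous_on {0..1} A"
  unfolding A_def[abs_def] by (intro continuous_on_set_lebesgue_integral_Icc set_integrable_\<alpha>)

lemma continuous_on_H: "continuous_on {0..1} H"
  unfolding H_def[abs_def] by (intro continuous_on_set_lebesgue_integral_Icc set_integrable_\<beta>)

lemma continuous_on_K: "continuous_on {0..1} K"
  unfolding K_def[abs_def]
  by (intro continuous_on_set_lebesgue_integral_Icc set_integrable_mult_continuous_on
      set_integrable_\<beta> continuous_on_A)

lemma continuous_on_T:
  assumes "continuous_on {0..1} f"
  shows "continuous_on {0..1} (T f)"
  unfolding T_def[abs_def]
  by (intro continuous_on_set_lebesgue_integral_Icc set_integrable_mult_continuous_on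
      set_integrable_\<beta> set_integrable_\<alpha> assms)

lemma T_cong:
  assumes "\<And>t. t \<in> {0..x} \<Longrightarrow> f t = g t"
  shows "T f x = T g x"
proof -
  have "(LINT t:{0..s}|lebesgue. \<alpha> t * f t) = (LINT t:{0..s}|lebesgue. \<alpha> t * g t)" if "s \<in> {0..x}" for s
    using that by (intro set_lebesgue_integral_cong) (auto simp: assms)
  then show ?thesis
    unfolding T_def by (intro set_lebesgue_integral_cong) auto
qed

lemma T_add:
  assumes f: "continuous_on {0..1} f" and g: "continuous_on {0..1} g" and "x \<le> 1"
  shows "T (\<lambda>t. f t + g t) x = T f x + T g x"
proof -
  have "(LINT t:{0..s}|lebesgue. \<alpha> t * (f t + g t)) =
      (LINT t:{0..s}|lebesgue. \<alpha> t * f t) + (LINT t:{0..s}|lebesgue. \<alpha> t * g t)" if "s \<le> 1" for s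
    unfolding distrib_left
    by (intro set_integral_add(2) set_integrable_01_le_mult_continuous_on set_integrable_\<alpha> f g that)
  then have "T (\<lambda>t. f t + g t) x = (LINT s:{0..x}|lebesgue. \<beta> s * (LINT t:{0..s}|lebesgue. \<alpha> t * f t) +
      \<beta> s * (LINT t:{0..s}|lebesgue. \<alpha> t * g t))"
    unfolding T_def using \<open>x \<le> 1\<close> by (intro set_lebesgue_integral_cong) (auto simp: distrib_left)
  also have "\<dots> = T f x + T g x"
    unfolding T_def
    by (intro set_integral_add(2) set_integrable_01_le_mult_continuous_on set_integrable_\<beta> \<open>x \<le> 1\<close>
        continuous_on_set_lebesgue_integral_Icc set_integrable_mult_continuous_on set_integrable_\<alpha> f g)
  finally show ?thesis .
qed

lemma T_cmult: "T (\<lambda>t. c * f t) x = c * T f x"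
proof -
  have "(LINT t:{0..s}|lebesgue. \<alpha> t * (c * f t)) = c * (LINT t:{0..s}|lebesgue. \<alpha> t * f t)" for s
    by (subst set_integral_mult_right[symmetric]) (simp add: ac_simps)
  then have "T (\<lambda>t. c * f t) x = (LINT s:{0..x}|lebesgue. c * (\<beta> s * (LINT t:{0..s}|lebesgue. \<alpha> t * f t)))"
    by (simp add: T_def ac_simps)
  then show ?thesis
    by (simp add: T_def)
qed

lemma T_one: "T (\<lambda>_. 1) = K"
  by (simp add: T_def[abs_def] K_def[abs_def] A_def)

text \<open>Integration by parts brings out \<open>A\<close>, whose product with \<open>\<beta>\<close> has modulus
  \<open>\<bar>\<sigma>\<^sub>2\<bar> \<gamma>\<^sub>0\<^sub>,\<^sub>1\<close> even where \<open>\<alpha>\<close> itself is exponentially large.\<close>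

lemma T_primitive:
  assumes g: "set_integrable lebesgue {0..1} g"
    and f: "\<And>t. t \<in> {0..x} \<Longrightarrow> f t = (LINT s:{0..t}|lebesgue. g s)" and "x \<le> 1"
  shows "T f x = (LINT s:{0..x}|lebesgue. \<beta> s * (A s * f s - (LINT t:{0..s}|lebesgue. g t * A t)))"
  unfolding T_def
proof (intro set_lebesgue_integral_cong allI impI)
  fix s assume s: "s \<in> {0..x}"
  have "(LINT t:{0..s}|lebesgue. \<alpha> t * f t) = (LINT t:{0..s}|lebesgue. \<alpha> t * (LINT s:{0..t}|lebesgue. g s))"
    using s by (intro set_lebesgue_integral_cong) (auto simp: f)
  also have "\<dots> = A s * f s - (LINT t:{0..s}|lebesgue. g t * A t)"
    using s \<open>x \<le> 1\<close> unfolding f[OF s] A_def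
    by (intro set_lebesgue_integral_Icc_by_parts set_integrable_01_le[OF set_integrable_\<alpha>]
        set_integrable_01_le[OF g]) auto
  finally show "\<beta> s * (LINT t:{0..s}|lebesgue. \<alpha> t * f t) =
      \<beta> s * (A s * f s - (LINT t:{0..s}|lebesgue. g t * A t))" by simp
qed simp

section \<open>Exponential factors and elementary estimates\<close>

lemma one_le_M: "1 \<le> M"
  using norm_exp_le[of 0] by simp

text \<open>The combined exponent is that of s - t, which lies in [0,1]. The second factor alone can
  be exponentially large when the imaginary part of \<mu> is large.\<close>

lemma norm_exp_diff_le:
  assumes "0 \<le> t" "t \<le> s" "s \<le> 1"
  shows "cmod (exp (2 * \<i> * \<mu> * of_real s) * exp (- 2 * \<i> * \<mu> * of_real t)) \<le> M"
  using norm_exp_le[of "s - t"] assms by (simp add: algebra_simps flip: exp_add)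

lemma gamma01_eq: "gamma01 \<sigma>\<^sub>1 s \<mu> = cmod (exp (2 * \<i> * \<mu> * of_real s) * A s)"
  unfolding gamma01_def A_def \<alpha>_def set_integral_mult_right[symmetric]
  by (simp add: algebra_simps flip: exp_add)

lemma continuous_on_gamma01: "continuous_on {0..1} (\<lambda>s. gamma01 \<sigma>\<^sub>1 s \<mu>)"
  unfolding gamma01_eq by (intro continuous_intros continuous_on_A)

lemma gamma01_nonneg [simp]: "0 \<le> gamma01 \<sigma>\<^sub>1 s \<mu>"
  by (simp add: gamma01_def)

lemma norm_\<beta>_le: "t \<in> {0..1} \<Longrightarrow> cmod (\<beta> t) \<le> M * cmod (\<sigma>\<^sub>2 t)"
  unfolding \<beta>_def norm_mult by (intro mult_right_mono norm_exp_le) auto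

lemma norm_\<beta>_A: "cmod (\<beta> t * A t) = cmod (\<sigma>\<^sub>2 t) * gamma01 \<sigma>\<^sub>1 t \<mu>"
  unfolding gamma01_eq \<beta>_def by (simp add: norm_mult)

lemma norm_exp_\<alpha>_le:
  assumes "0 \<le> t" "t \<le> s" "s \<le> 1"
  shows "cmod (exp (2 * \<i> * \<mu> * of_real s) * \<alpha> t) \<le> M * cmod (\<sigma>\<^sub>1 t)"
  using mult_right_mono[OF norm_exp_diff_le[OF assms], of "cmod (\<sigma>\<^sub>1 t)"]
  by (simp add: \<alpha>_def norm_mult mult.assoc)

text \<open>Turning both factors \<open>A t\<close> into \<open>gamma01\<close> takes two
  exponentials at t, while \<beta> supplies one. The missing one is inserted together with its
  inverse, which pairs with the exponential at s.\<close>

lemma norm_exp_\<beta>_A2_le: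
  assumes "0 \<le> t" "t \<le> s" "s \<le> 1"
  shows "cmod (exp (2 * \<i> * \<mu> * of_real s) * (\<beta> t * (A t)\<^sup>2)) \<le>
    M * (cmod (\<sigma>\<^sub>2 t) * (gamma01 \<sigma>\<^sub>1 t \<mu>)\<^sup>2)"
proof -
  let ?e = "\<lambda>t. exp (2 * \<i> * \<mu> * of_real t)" and ?n = "exp (- 2 * \<i> * \<mu> * of_real t)"
  have "?n * ?e t = 1"
    by (simp flip: exp_add)
  then have "?e s * (\<beta> t * (A t)\<^sup>2) = (?n * ?e t) * (?e s * (\<beta> t * (A t)\<^sup>2))"
    by (simp only: mult_1)
  also have "\<dots> = (?e s * ?n) * (\<sigma>\<^sub>2 t * (?e t * A t)\<^sup>2)"
    by (simp add: \<beta>_def power2_eq_square ac_simps)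
  finally show ?thesis
    using mult_right_mono[OF norm_exp_diff_le[OF assms], of "cmod (\<sigma>\<^sub>2 t) * (gamma01 \<sigma>\<^sub>1 t \<mu>)\<^sup>2"]
    by (simp add: gamma01_eq norm_mult norm_power)
qed

lemma set_integrable_norm_\<sigma>:
  "set_integrable lebesgue {0..1} (\<lambda>t. cmod (\<sigma>\<^sub>1 t))"
  "set_integrable lebesgue {0..1} (\<lambda>t. cmod (\<sigma>\<^sub>2 t))"
  by (intro set_integrable_norm \<sigma>\<^sub>1 \<sigma>\<^sub>2)+

lemma set_integrable_kq:
  "set_integrable lebesgue {0..1} (\<lambda>t. cmod (\<sigma>\<^sub>2 t) * gamma01 \<sigma>\<^sub>1 t \<mu>)"
  "set_integrable lebesgue {0..1} (\<lambda>t. cmod (\<sigma>\<^sub>2 t) * (gamma01 \<sigma>\<^sub>1 t \<mu>)\<^sup>2)"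
  by (intro set_integrable_mult_continuous_on set_integrable_norm_\<sigma> continuous_intros continuous_on_gamma01)+

lemma nonneg: "0 \<le> S" "0 \<le> P" "0 \<le> k" "0 \<le> q"
  unfolding S_def P_def k_def q_def set_lebesgue_integral_def
  by (auto intro!: Bochner_Integration.integral_nonneg)

lemma k_square_le: "k\<^sup>2 \<le> S * q"
  unfolding k_def S_def q_def
  by (intro set_lebesgue_integral_weighted_Cauchy_Schwarz set_integrable_norm_\<sigma> continuous_on_gamma01) simp

lemma norm_H_le: "x \<in> {0..1} \<Longrightarrow> cmod (H x) \<le> M * S"
  unfolding H_def S_def set_integral_mult_right[symmetric]
  using one_le_M
  by (intro norm_set_lebesgue_integral_le set_integrable_mult_right set_integrable_norm_\<sigma>)
    (auto intro: norm_\<beta>_le)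

lemma norm_K_le: "x \<in> {0..1} \<Longrightarrow> cmod (K x) \<le> k"
  unfolding K_def k_def
  by (intro norm_set_lebesgue_integral_le set_integrable_kq) (auto simp: norm_\<beta>_A)

text \<open>The exponential of \<open>\<beta> s\<close> moves under the integral, where it offsets
  the growth of integrands built from \<alpha> or A.\<close>

lemma norm_\<beta>_mult_integral:
  "cmod (\<beta> s * (LINT t:X|lebesgue. f t)) =
   cmod (\<sigma>\<^sub>2 s) * cmod (LINT t:X|lebesgue. exp (2 * \<i> * \<mu> * of_real s) * f t)"
  by (simp add: \<beta>_def norm_mult)

lemma set_integrable_kS:
  "set_integrable lebesgue {0..1} (\<lambda>t. (cmod (\<sigma>\<^sub>2 t) * gamma01 \<sigma>\<^sub>1 t \<mu>) * b + cmod (\<sigma>\<^sub>2 t) * c)"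
  and integral_kS:
  "(LINT t:{0..1}|lebesgue. (cmod (\<sigma>\<^sub>2 t) * gamma01 \<sigma>\<^sub>1 t \<mu>) * b + cmod (\<sigma>\<^sub>2 t) * c) = k * b + S * c"
proof -
  have *: "set_integrable lebesgue {0..1} (\<lambda>t. (cmod (\<sigma>\<^sub>2 t) * gamma01 \<sigma>\<^sub>1 t \<mu>) * b)"
    "set_integrable lebesgue {0..1} (\<lambda>t. cmod (\<sigma>\<^sub>2 t) * c)"
    by (intro set_integrable_mult_left set_integrable_kq set_integrable_norm_\<sigma>)+
  show "set_integrable lebesgue {0..1} (\<lambda>t. (cmod (\<sigma>\<^sub>2 t) * gamma01 \<sigma>\<^sub>1 t \<mu>) * b + cmod (\<sigma>\<^sub>2 t) * c)"
    using * by (rule set_integral_add(1))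
  show "(LINT t:{0..1}|lebesgue. (cmod (\<sigma>\<^sub>2 t) * gamma01 \<sigma>\<^sub>1 t \<mu>) * b + cmod (\<sigma>\<^sub>2 t) * c) = k * b + S * c"
    using set_integral_add(2)[OF *] by (simp add: k_def S_def)
qed

text \<open>Common pattern of the later estimates: a term with the factor \<beta> A costs
  \<open>k\<close>, a term with only \<open>\<sigma>\<^sub>2\<close> costs \<open>S\<close>.\<close>

lemma norm_integral_kS_le:
  assumes "x \<in> {0..1}" "0 \<le> b" "0 \<le> c"
    and "\<And>t. t \<in> {0..x} \<Longrightarrow> cmod (f t) \<le> (cmod (\<sigma>\<^sub>2 t) * gamma01 \<sigma>\<^sub>1 t \<mu>) * b + cmod (\<sigma>\<^sub>2 t) * c"
  shows "cmod (LINT t:{0..x}|lebesgue. f t) \<le> k * b + S * c"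
  unfolding integral_kS[symmetric] using assms
  by (intro norm_set_lebesgue_integral_le set_integrable_kS) auto

text \<open>This is how \<open>q\<close> enters: the exponential of the outer
  \<open>\<beta> s\<close> completes the two inner factors A to the square of
  \<open>gamma01\<close>.\<close>

lemma norm_\<beta>_integral_A2_le:
  assumes "s \<in> {0..1}" "0 \<le> B" "\<And>t. t \<in> {0..1} \<Longrightarrow> cmod (f t) \<le> B"
  shows "cmod (\<beta> s * (LINT t:{0..s}|lebesgue. \<beta> t * (A t)\<^sup>2 * f t)) \<le> cmod (\<sigma>\<^sub>2 s) * (M * q * B)"
proof -
  have "cmod (LINT t:{0..s}|lebesgue. exp (2 * \<i> * \<mu> * of_real s) * (\<beta> t * (A t)\<^sup>2 * f t)) \<le>
      (LINT t:{0..1}|lebesgue. M * (cmod (\<sigma>\<^sub>2 t) * (gamma01 \<sigma>\<^sub>1 t \<mu>)\<^sup>2) * B)"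
  proof (intro norm_set_lebesgue_integral_le set_integrable_mult_left set_integrable_mult_right set_integrable_kq)
    fix t assume t: "t \<in> {0..s}"
    have "cmod (exp (2 * \<i> * \<mu> * of_real s) * (\<beta> t * (A t)\<^sup>2)) * cmod (f t) \<le>
        M * (cmod (\<sigma>\<^sub>2 t) * (gamma01 \<sigma>\<^sub>1 t \<mu>)\<^sup>2) * B"
      using t assms one_le_M by (intro mult_mono norm_exp_\<beta>_A2_le) auto
    then show "cmod (exp (2 * \<i> * \<mu> * of_real s) * (\<beta> t * (A t)\<^sup>2 * f t)) \<le>
        M * (cmod (\<sigma>\<^sub>2 t) * (gamma01 \<sigma>\<^sub>1 t \<mu>)\<^sup>2) * B"
      by (simp add: norm_mult mult.assoc)
  qed (use assms one_le_M in auto)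
  also have "\<dots> = M * q * B"
    by (simp add: q_def)
  finally show ?thesis
    unfolding norm_\<beta>_mult_integral by (rule mult_left_mono) simp
qed

section \<open>The iterates of T, estimated through k and q\<close>

lemma T_H:
  assumes "x \<in> {0..1}"
  shows "T H x = (LINT s:{0..x}|lebesgue. \<beta> s * (A s * H s - K s))"
  using assms by (subst T_primitive[OF set_integrable_\<beta>]) (auto simp: H_def K_def)

text \<open>After integration by parts each term contains \<beta> A or K, hence one factor
  \<open>k\<close>; a second such factor in later products makes them quadratic.\<close>

lemma norm_T_H_le:
  assumes "x \<in> {0..1}"
  shows "cmod (T H x) \<le> 2 * M * S * k"
proof -
  have "cmod (T H x) \<le> k * (M * S) + S * (M * k)"
    unfolding T_H[OF assms]
  proof (rule norm_integral_kS_le)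
    fix s assume "s \<in> {0..x}"
    with assms have s: "s \<in> {0..1}" by auto
    have "cmod (\<beta> s * (A s * H s - K s)) \<le> cmod (\<beta> s * A s) * cmod (H s) + cmod (\<beta> s) * cmod (K s)"
      unfolding norm_mult[symmetric] right_diff_distrib mult.assoc[symmetric] by (rule norm_triangle_ineq4)
    also have "\<dots> \<le> cmod (\<beta> s * A s) * (M * S) + (M * cmod (\<sigma>\<^sub>2 s)) * k"
      using s one_le_M nonneg by (intro add_mono mult_mono norm_H_le norm_K_le norm_\<beta>_le) auto
    finally show "cmod (\<beta> s * (A s * H s - K s)) \<le>
        (cmod (\<sigma>\<^sub>2 s) * gamma01 \<sigma>\<^sub>1 s \<mu>) * (M * S) + cmod (\<sigma>\<^sub>2 s) * (M * k)"
      unfolding norm_\<beta>_A by (simp add: mult_ac)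
  qed (use assms one_le_M nonneg in auto)
  then show ?thesis by (simp add: mult_ac)
qed

text \<open>K is the primitive of \<beta> A, so integration by parts leaves \<beta> A K, which costs
  \<open>k * k\<close>, and \<beta> times the integral of \<beta> A^2, which costs
  \<open>q\<close>.\<close>

lemma norm_T_K_le:
  assumes "x \<in> {0..1}"
  shows "cmod (T K x) \<le> 2 * M * S * q"
proof -
  have eq: "T K x = (LINT s:{0..x}|lebesgue. \<beta> s * (A s * K s - (LINT t:{0..s}|lebesgue. \<beta> t * A t * A t)))"
    using assms by (intro T_primitive set_integrable_mult_continuous_on set_integrable_\<beta> continuous_on_A)
      (auto simp: K_def)
  have "cmod (T K x) \<le> k * k + S * (M * q * 1)"
    unfolding eq
  proof (rule norm_integral_kS_le)
    fix s assume "s \<in> {0..x}"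
    with assms have s: "s \<in> {0..1}" by auto
    have "cmod (\<beta> s * (A s * K s - (LINT t:{0..s}|lebesgue. \<beta> t * A t * A t))) \<le>
        cmod (\<beta> s * A s) * cmod (K s) + cmod (\<beta> s * (LINT t:{0..s}|lebesgue. \<beta> t * (A t)\<^sup>2 * 1))"
      unfolding norm_mult[of "\<beta> s * A s", symmetric] right_diff_distrib mult.assoc[symmetric] power2_eq_square mult_1_right
      by (rule norm_triangle_ineq4)
    also have "\<dots> \<le> cmod (\<beta> s * A s) * k + cmod (\<sigma>\<^sub>2 s) * (M * q * 1)"
      using s by (intro add_mono mult_left_mono norm_K_le norm_\<beta>_integral_A2_le) auto
    finally show "cmod (\<beta> s * (A s * K s - (LINT t:{0..s}|lebesgue. \<beta> t * A t * A t))) \<le>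
        (cmod (\<sigma>\<^sub>2 s) * gamma01 \<sigma>\<^sub>1 s \<mu>) * k + cmod (\<sigma>\<^sub>2 s) * (M * q * 1)"
      by (simp add: norm_\<beta>_A)
  qed (use assms one_le_M nonneg in auto)
  also have "\<dots> \<le> S * q + S * (M * q)"
    using k_square_le by (simp add: power2_eq_square)
  also have "\<dots> \<le> S * (M * q) + S * (M * q)"
    using one_le_M nonneg by (intro add_right_mono mult_left_mono) (auto simp: mult_le_cancel_right1)
  finally show ?thesis by (simp add: mult_ac)
qed

text \<open>By \<open>T_H\<close>, \<open>T H\<close> is the primitive of g = \<beta> (A H - K), so
  integration by parts can be repeated. In the integral of g A the part \<beta> A K integrates
  exactly to K^2/2, as K is the primitive of \<beta> A; all resulting terms are of order
  \<open>k\<^sup>2\<close> or \<open>q\<close>.\<close>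

lemma norm_T_T_H_le:
  assumes "x \<in> {0..1}"
  shows "cmod (T (T H) x) \<le> 4 * M\<^sup>2 * S\<^sup>2 * q"
proof -
  define g where "g s = \<beta> s * (A s * H s - K s)" for s
  have intK: "set_integrable lebesgue {0..1} (\<lambda>t. \<beta> t * A t)"
    by (intro set_integrable_mult_continuous_on set_integrable_\<beta> continuous_on_A)
  have int_g: "set_integrable lebesgue {0..1} g"
    unfolding g_def by (intro set_integrable_mult_continuous_on set_integrable_\<beta> continuous_intros
        continuous_on_A continuous_on_H continuous_on_K)
  have gA: "(LINT t:{0..s}|lebesgue. g t * A t) =
      (LINT t:{0..s}|lebesgue. \<beta> t * (A t)\<^sup>2 * H t) - (K s)\<^sup>2 / 2" if "s \<in> {0..1}" for s
  proof -
    have "(LINT t:{0..s}|lebesgue. g t * A t) =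
        (LINT t:{0..s}|lebesgue. \<beta> t * ((A t)\<^sup>2 * H t) - \<beta> t * A t * K t)"
      by (simp add: g_def power2_eq_square algebra_simps)
    also have "\<dots> = (LINT t:{0..s}|lebesgue. \<beta> t * ((A t)\<^sup>2 * H t)) - (LINT t:{0..s}|lebesgue. \<beta> t * A t * K t)"
      using that by (intro set_integral_diff(2) set_integrable_01_le_mult_continuous_on intK set_integrable_\<beta>
          continuous_intros continuous_on_A continuous_on_H continuous_on_K) auto
    also have "(LINT t:{0..s}|lebesgue. \<beta> t * A t * K t) = (K s)\<^sup>2 / 2"
      using set_lebesgue_integral_Icc_power[OF set_integrable_01_le[OF intK], of s 1] that
      by (simp add: K_def power2_eq_square)
    finally show ?thesis by (simp add: mult.assoc)
  qed
  have eq: "T (T H) x = (LINT s:{0..x}|lebesgue. \<beta> s * (A s * T H s - (LINT t:{0..s}|lebesgue. g t * A t)))"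
    using assms by (intro T_primitive int_g) (auto simp: T_H g_def)
  have "cmod (T (T H) x) \<le> k * (2 * M * S * k) + S * (M * q * (M * S) + M * (k\<^sup>2 / 2))"
    unfolding eq
  proof (rule norm_integral_kS_le)
    fix s assume "s \<in> {0..x}"
    with assms have s: "s \<in> {0..1}" by auto
    let ?J = "LINT t:{0..s}|lebesgue. \<beta> t * (A t)\<^sup>2 * H t"
    have eq': "\<beta> s * (A s * T H s - (LINT t:{0..s}|lebesgue. g t * A t)) =
        \<beta> s * A s * T H s - \<beta> s * ?J + \<beta> s * ((K s)\<^sup>2 / 2)"
      unfolding gA[OF s] by (simp add: algebra_simps)
    have "cmod (\<beta> s * (A s * T H s - (LINT t:{0..s}|lebesgue. g t * A t))) \<le>
        cmod (\<beta> s * A s) * cmod (T H s) + cmod (\<beta> s * ?J) + cmod (\<beta> s) * ((cmod (K s))\<^sup>2 / 2)"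
      unfolding eq'
      using norm_triangle_ineq[of "\<beta> s * A s * T H s - \<beta> s * ?J" "\<beta> s * ((K s)\<^sup>2 / 2)"]
        norm_triangle_ineq4[of "\<beta> s * A s * T H s" "\<beta> s * ?J"]
      by (simp add: norm_mult norm_power norm_divide)
    also have "\<dots> \<le> cmod (\<beta> s * A s) * (2 * M * S * k) + cmod (\<sigma>\<^sub>2 s) * (M * q * (M * S)) +
        (M * cmod (\<sigma>\<^sub>2 s)) * (k\<^sup>2 / 2)"
      using s one_le_M nonneg
      by (intro add_mono mult_mono divide_right_mono power_mono norm_T_H_le norm_K_le norm_\<beta>_le
          norm_\<beta>_integral_A2_le norm_H_le) auto
    finally show "cmod (\<beta> s * (A s * T H s - (LINT t:{0..s}|lebesgue. g t * A t))) \<le>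
        (cmod (\<sigma>\<^sub>2 s) * gamma01 \<sigma>\<^sub>1 s \<mu>) * (2 * M * S * k) +
        cmod (\<sigma>\<^sub>2 s) * (M * q * (M * S) + M * (k\<^sup>2 / 2))"
      unfolding norm_\<beta>_A by (simp add: algebra_simps)
  qed (use assms one_le_M nonneg in auto)
  \<comment> \<open>5/2 is 2 from \<beta> A (T H) plus 1/2 from K^2/2. With
    \<open>k\<^sup>2 \<le> S * q\<close> and M >= 1 the total 7/2 is rounded up to 4.\<close>
  also have "\<dots> = (5 / 2 * M * S) * k\<^sup>2 + M\<^sup>2 * S\<^sup>2 * q"
    by (simp add: power2_eq_square algebra_simps)
  also have "\<dots> \<le> (5 / 2 * M * S) * (S * q) + M\<^sup>2 * S\<^sup>2 * q"
    using k_square_le one_le_M nonneg by (intro add_right_mono mult_left_mono) auto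
  also have "\<dots> = 5 / 2 * (M * (S\<^sup>2 * q)) + M\<^sup>2 * S\<^sup>2 * q"
    by (simp add: power2_eq_square)
  also have "\<dots> \<le> 5 / 2 * (M\<^sup>2 * (S\<^sup>2 * q)) + M\<^sup>2 * S\<^sup>2 * q"
    using one_le_M nonneg by (intro add_right_mono mult_left_mono mult_right_mono) (auto simp: power2_eq_square)
  also have "\<dots> \<le> 4 * M\<^sup>2 * S\<^sup>2 * q"
    using nonneg by simp
  finally show ?thesis by simp
qed

section \<open>Gronwall bound for the Volterra equation and the Neumann remainder\<close>

text \<open>The right side is free of s, so one bound serves the inner integral of T for every s up
  to x.\<close>

lemma norm_exp_integral_\<alpha>_le:
  assumes f: "continuous_on {0..1} f" and "0 \<le> s" "s \<le> x" "x \<le> 1"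
  shows "cmod (LINT t:{0..s}|lebesgue. exp (2 * \<i> * \<mu> * of_real s) * (\<alpha> t * f t)) \<le>
    M * (LINT t:{0..x}|lebesgue. cmod (\<sigma>\<^sub>1 t) * cmod (f t))"
  unfolding set_integral_mult_right[symmetric]
proof (intro norm_set_lebesgue_integral_le set_integrable_mult_right set_integrable_01_le_mult_continuous_on
    set_integrable_norm_\<sigma> continuous_intros f)
  fix t assume "t \<in> {0..s}"
  then show "cmod (exp (2 * \<i> * \<mu> * of_real s) * (\<alpha> t * f t)) \<le> M * (cmod (\<sigma>\<^sub>1 t) * cmod (f t))"
    using mult_right_mono[OF norm_exp_\<alpha>_le[of t s], of "cmod (f t)"] assms
    by (simp add: norm_mult mult.assoc)
qed (use assms one_le_M in auto)

lemma norm_exp_mult_integral_\<alpha>_le: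
  assumes f: "continuous_on {0..1} f" "\<And>t. t \<in> {0..1} \<Longrightarrow> cmod (f t) \<le> B" and x: "x \<in> {0..1}"
  shows "cmod (exp (2 * \<i> * \<mu> * of_real x) * (LINT t:{0..x}|lebesgue. \<alpha> t * f t)) \<le> M * (P * B)"
proof -
  have "cmod (exp (2 * \<i> * \<mu> * of_real x) * (LINT t:{0..x}|lebesgue. \<alpha> t * f t)) \<le>
      M * (LINT t:{0..1}|lebesgue. cmod (\<sigma>\<^sub>1 t) * cmod (f t))"
    using norm_exp_integral_\<alpha>_le[OF f(1), of x 1] x by simp
  also have "(LINT t:{0..1}|lebesgue. cmod (\<sigma>\<^sub>1 t) * cmod (f t)) \<le> (LINT t:{0..1}|lebesgue. cmod (\<sigma>\<^sub>1 t) * B)"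
    using f by (intro set_integral_mono set_integrable_mult_left set_integrable_mult_continuous_on
        set_integrable_norm_\<sigma> continuous_intros mult_left_mono) auto
  finally show ?thesis
    using one_le_M by (simp add: P_def)
qed

text \<open>For t <= s the product \<open>\<beta> s * \<alpha> t\<close> has modulus at most
  \<open>M * cmod (\<sigma>\<^sub>2 s) * cmod (\<sigma>\<^sub>1 t)\<close>. Integrating out s gives
  S, and Gronwall applies with the remaining weight in t.\<close>

lemma volterra_bound:
  assumes V: "continuous_on {0..1} V"
    and eq: "\<And>x. x \<in> {0..1} \<Longrightarrow> V x = F x + T V x"
    and F: "\<And>x. x \<in> {0..1} \<Longrightarrow> cmod (F x) \<le> \<epsilon>"
    and x: "x \<in> {0..1}"
  shows "cmod (V x) \<le> \<epsilon> * exp (M * S * P)"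
proof -
  have TV: "cmod (T V x) \<le> (LINT t:{0..x}|lebesgue. M * S * cmod (\<sigma>\<^sub>1 t) * cmod (V t))"
    if x: "x \<in> {0..1}" for x
  proof -
    let ?R = "LINT t:{0..x}|lebesgue. cmod (\<sigma>\<^sub>1 t) * cmod (V t)"
    have R: "0 \<le> ?R"
      unfolding set_lebesgue_integral_def by (auto intro!: Bochner_Integration.integral_nonneg)
    have "cmod (T V x) \<le> k * 0 + S * (M * ?R)"
      unfolding T_def
    proof (rule norm_integral_kS_le)
      fix s assume s: "s \<in> {0..x}"
      then show "cmod (\<beta> s * (LINT t:{0..s}|lebesgue. \<alpha> t * V t)) \<le>
          (cmod (\<sigma>\<^sub>2 s) * gamma01 \<sigma>\<^sub>1 s \<mu>) * 0 + cmod (\<sigma>\<^sub>2 s) * (M * ?R)"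
        using x mult_left_mono[OF norm_exp_integral_\<alpha>_le[OF V, of s x], of "cmod (\<sigma>\<^sub>2 s)"]
        unfolding norm_\<beta>_mult_integral by simp
    qed (use x R one_le_M in auto)
    also have "\<dots> = (LINT t:{0..x}|lebesgue. M * S * cmod (\<sigma>\<^sub>1 t) * cmod (V t))"
      by (simp add: mult.assoc)
    finally show ?thesis .
  qed
  have "cmod (V x) \<le> \<epsilon> * exp (LINT t:{0..x}|lebesgue. M * S * cmod (\<sigma>\<^sub>1 t))"
  proof (rule gronwall_set_lebesgue_integral[OF _ _ _ _ x])
    show "set_integrable lebesgue {0..1} (\<lambda>t. M * S * cmod (\<sigma>\<^sub>1 t))"
      by (intro set_integrable_mult_right set_integrable_norm_\<sigma>)
    show "continuous_on {0..1} (\<lambda>x. cmod (V x))"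
      by (intro continuous_intros V)
    show "cmod (V x) \<le> \<epsilon> + (LINT t:{0..x}|lebesgue. M * S * cmod (\<sigma>\<^sub>1 t) * cmod (V t))" if "x \<in> {0..1}" for x
      using norm_triangle_ineq[of "F x" "T V x"] F[OF that] TV[OF that] eq[OF that] by simp
  qed (use one_le_M nonneg in auto)
  also have "\<dots> \<le> \<epsilon> * exp (M * S * P)"
  proof (intro mult_left_mono)
    \<comment> \<open>Passing to the modulus lets the domination lemma compare the integrals over
      [0,x] and [0,1].\<close>
    have "cmod (of_real (LINT t:{0..x}|lebesgue. cmod (\<sigma>\<^sub>1 t))) \<le> P"
      unfolding norm_of_real real_norm_def[symmetric] P_def using x
      by (intro norm_set_lebesgue_integral_le set_integrable_norm_\<sigma>) auto
    then show "exp (LINT t:{0..x}|lebesgue. M * S * cmod (\<sigma>\<^sub>1 t)) \<le> exp (M * S * P)"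
      using one_le_M nonneg by (auto intro!: mult_left_mono)
    show "0 \<le> \<epsilon>"
      using F[OF x] norm_ge_zero[of "F x"] by linarith
  qed
  finally show ?thesis .
qed

text \<open>Subtracting the Neumann terms f and T f with f = c + d H leaves a solution of the same
  equation with source T (T f) = c T K + d T (T H), which is bounded by a multiple of
  \<open>q\<close>.\<close>

lemma remainder_bound:
  assumes v: "continuous_on {0..1} v"
    and eq: "\<And>x. x \<in> {0..1} \<Longrightarrow> v x = c + d * H x + T v x"
    and x: "x \<in> {0..1}"
  shows "cmod (v x - (c + d * H x) - (c * K x + d * T H x)) \<le>
    (cmod c * (2 * M * S) + cmod d * (4 * M\<^sup>2 * S\<^sup>2)) * exp (M * S * P) * q"
proof -
  define V where "V x = v x - (c + d * H x) - (c * K x + d * T H x)" for x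
  have V: "continuous_on {0..1} V"
    unfolding V_def by (intro continuous_intros v continuous_on_H continuous_on_K continuous_on_T)
  have "V x = (c * T K x + d * T (T H) x) + T V x" if x: "x \<in> {0..1}" for x
  proof -
    have "V x = T v x - (c * K x + d * T H x)"
      using eq[OF x] by (simp add: V_def)
    \<comment> \<open>The constant is written c * 1 so that linearity reduces it to T of 1, which is
      K.\<close>
    also have "T v x = T (\<lambda>x. V x + ((c * 1 + d * H x) + (c * K x + d * T H x))) x"
      by (rule T_cong) (simp add: V_def)
    also have "\<dots> = T V x + ((c * K x + d * T H x) + (c * T K x + d * T (T H) x))"
      using x
      by (simp add: T_add T_cmult V continuous_on_H continuous_on_K continuous_on_T T_one continuous_intros
          del: mult_1_right)
    finally show ?thesis by simp
  qed
  moreover have "cmod (c * T K x + d * T (T H) x) \<le> (cmod c * (2 * M * S) + cmod d * (4 * M\<^sup>2 * S\<^sup>2)) * q"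
    if "x \<in> {0..1}" for x
    using norm_triangle_ineq[of "c * T K x" "d * T (T H) x"]
      mult_left_mono[OF norm_T_K_le[OF that], of "cmod c"]
      mult_left_mono[OF norm_T_T_H_le[OF that], of "cmod d"]
    by (simp add: norm_mult algebra_simps)
  ultimately have "cmod (V x) \<le> ((cmod c * (2 * M * S) + cmod d * (4 * M\<^sup>2 * S\<^sup>2)) * q) * exp (M * S * P)"
    by (intro volterra_bound[OF V _ _ x])
  then show ?thesis
    by (simp add: V_def mult_ac)
qed

section \<open>Solutions of the Dirac system\<close>

text \<open>Variation of constants for both components; the formula for the first is inserted into
  the second, which leaves an equation for v alone.\<close>

lemma dirac_solution_integral_equations:
  assumes sol: "dirac_solution \<sigma>\<^sub>1 \<sigma>\<^sub>2 \<mu> y\<^sub>1 y\<^sub>2" and x: "x \<in> {0..1}"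
  defines "v \<equiv> \<lambda>t. exp (\<i> * \<mu> * of_real t) * y\<^sub>2 t"
  shows "exp (- \<i> * \<mu> * of_real x) * y\<^sub>1 x = y\<^sub>1 0 - (LINT t:{0..x}|lebesgue. \<alpha> t * v t)"
    and "v x = y\<^sub>2 0 - y\<^sub>1 0 * H x + T v x"
    and "continuous_on {0..1} v"
proof -
  from sol have ac: "abs_continuous_on_interval 0 1 y\<^sub>1" "abs_continuous_on_interval 0 1 y\<^sub>2"
    and ae: "AE x in lebesgue_on {0..1}. \<exists>d\<^sub>1 d\<^sub>2.
        (y\<^sub>1 has_vector_derivative d\<^sub>1) (at x within {0..1}) \<and>
        (y\<^sub>2 has_vector_derivative d\<^sub>2) (at x within {0..1}) \<and>
        d\<^sub>1 + \<sigma>\<^sub>1 x * y\<^sub>2 x = \<i> * \<mu> * y\<^sub>1 x \<and> d\<^sub>2 + \<sigma>\<^sub>2 x * y\<^sub>1 x = - \<i> * \<mu> * y\<^sub>2 x"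
    by (auto simp: dirac_solution_def)
  note cont = ac[THEN abs_continuous_on_interval_imp_continuous_on]
  show v: "continuous_on {0..1} v"
    unfolding v_def by (intro continuous_intros cont)
  have neg: "set_integrable lebesgue {0..1} (\<lambda>t. - (\<sigma>\<^sub>1 t * y\<^sub>2 t))"
    "set_integrable lebesgue {0..1} (\<lambda>t. - (\<sigma>\<^sub>2 t * y\<^sub>1 t))"
    using set_integrable_mult_continuous_on[OF \<sigma>\<^sub>1 cont(2)]
      set_integrable_mult_continuous_on[OF \<sigma>\<^sub>2 cont(1)]
    by (simp_all add: set_integrable_def)
  have ae\<^sub>1: "AE x in lebesgue_on {0..1}.
      (y\<^sub>1 has_vector_derivative (\<i> * \<mu>) * y\<^sub>1 x + - (\<sigma>\<^sub>1 x * y\<^sub>2 x)) (at x within {0..1})"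
    using ae by (rule AE_mp) (auto intro!: AE_I2 simp: eq_diff_eq[symmetric] mult.assoc)
  have u: "exp (- \<i> * \<mu> * of_real x) * y\<^sub>1 x = y\<^sub>1 0 - (LINT t:{0..x}|lebesgue. \<alpha> t * v t)"
    if "x \<in> {0..1}" for x
  proof -
    have "exp (- (\<i> * \<mu>) * of_real x) * y\<^sub>1 x =
        y\<^sub>1 0 + (LINT t:{0..x}|lebesgue. exp (- (\<i> * \<mu>) * of_real t) * - (\<sigma>\<^sub>1 t * y\<^sub>2 t))"
      using integral_equation_abs_continuous_on_interval[OF ac(1) neg(1) ae\<^sub>1 that] by simp
    \<comment> \<open>Splitting off the exponential contained in v leaves the one of \<alpha>; the
      explicit factor -1 lets the sign be pulled out of the integral.\<close>
    also have "(\<lambda>t. exp (- (\<i> * \<mu>) * of_real t) * - (\<sigma>\<^sub>1 t * y\<^sub>2 t)) = (\<lambda>t. - 1 * (\<alpha> t * v t))"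
    proof
      fix t
      have "exp (- (\<i> * \<mu>) * of_real t) = exp (- 2 * \<i> * \<mu> * of_real t) * exp (\<i> * \<mu> * of_real t)"
        by (simp add: algebra_simps flip: exp_add)
      then show "exp (- (\<i> * \<mu>) * of_real t) * - (\<sigma>\<^sub>1 t * y\<^sub>2 t) = - 1 * (\<alpha> t * v t)"
        by (simp add: \<alpha>_def v_def)
    qed
    finally show ?thesis by (simp only: set_integral_mult_right) simp
  qed
  show "exp (- \<i> * \<mu> * of_real x) * y\<^sub>1 x = y\<^sub>1 0 - (LINT t:{0..x}|lebesgue. \<alpha> t * v t)"
    by (rule u) (rule x)
  have "AE x in lebesgue_on {0..1}.
      (y\<^sub>2 has_vector_derivative (- (\<i> * \<mu>)) * y\<^sub>2 x + - (\<sigma>\<^sub>2 x * y\<^sub>1 x)) (at x within {0..1})"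
    using ae by (rule AE_mp) (auto intro!: AE_I2 simp: eq_diff_eq[symmetric] mult.assoc)
  from integral_equation_abs_continuous_on_interval[OF ac(2) neg(2) this x]
  have "v x = y\<^sub>2 0 + (LINT t:{0..x}|lebesgue. exp (\<i> * \<mu> * of_real t) * - (\<sigma>\<^sub>2 t * y\<^sub>1 t))"
    by (simp add: v_def)
  also have "(LINT t:{0..x}|lebesgue. exp (\<i> * \<mu> * of_real t) * - (\<sigma>\<^sub>2 t * y\<^sub>1 t)) =
      (LINT t:{0..x}|lebesgue. \<beta> t * (LINT t:{0..t}|lebesgue. \<alpha> t * v t) - \<beta> t * y\<^sub>1 0)"
  proof (intro set_lebesgue_integral_cong allI impI)
    fix t assume "t \<in> {0..x}"
    with x have t: "t \<in> {0..1}" by auto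
    have "exp (\<i> * \<mu> * of_real t) = exp (2 * \<i> * \<mu> * of_real t) * exp (- \<i> * \<mu> * of_real t)"
      by (simp add: algebra_simps flip: exp_add)
    then have "exp (\<i> * \<mu> * of_real t) * - (\<sigma>\<^sub>2 t * y\<^sub>1 t) = - (\<beta> t * (exp (- \<i> * \<mu> * of_real t) * y\<^sub>1 t))"
      by (simp add: \<beta>_def)
    then show "exp (\<i> * \<mu> * of_real t) * - (\<sigma>\<^sub>2 t * y\<^sub>1 t) =
        \<beta> t * (LINT t:{0..t}|lebesgue. \<alpha> t * v t) - \<beta> t * y\<^sub>1 0"
      unfolding u[OF t] by (simp add: algebra_simps)
  qed simp
  also have "\<dots> = T v x - H x * y\<^sub>1 0"
    unfolding T_def H_def set_integral_mult_left[symmetric] using x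
    by (intro set_integral_diff(2) set_integrable_01_le_mult_continuous_on set_integrable_\<beta>
        continuous_on_set_lebesgue_integral_Icc set_integrable_mult_continuous_on set_integrable_\<alpha> v
        continuous_intros) auto
  finally show "v x = y\<^sub>2 0 - y\<^sub>1 0 * H x + T v x"
    by simp
qed

text \<open>The sign in \<open>y\<^sub>1 0 = - d\<close> makes the equation read v = c + d H + T v.
  For the first component the remainder is integrated once more against \<alpha>, which costs the
  factor \<open>M * P\<close>. Both components are multiplied by
  \<open>exp (\<i> * \<mu> * of_real x)\<close> because the claimed errors carry the inverse
  factor.\<close>

lemma exp_solution_remainder:
  assumes sol: "dirac_solution \<sigma>\<^sub>1 \<sigma>\<^sub>2 \<mu> y\<^sub>1 y\<^sub>2" and "y\<^sub>1 0 = - d" "y\<^sub>2 0 = c"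
    and cd: "cmod c \<le> 1" "cmod d \<le> 1" and x: "x \<in> {0..1}"
  defines "B \<equiv> (2 * M * S + 4 * M\<^sup>2 * S\<^sup>2) * exp (M * S * P)"
  shows "cmod (exp (\<i> * \<mu> * of_real x) * y\<^sub>2 x - (c + d * H x) - (c * K x + d * T H x)) \<le> B * q"
    and "cmod (exp (\<i> * \<mu> * of_real x) * y\<^sub>1 x + exp (2 * \<i> * \<mu> * of_real x) *
      (d + c * A x + d * (LINT t:{0..x}|lebesgue. \<alpha> t * H t) + c * (LINT t:{0..x}|lebesgue. \<alpha> t * K t) +
       d * (LINT t:{0..x}|lebesgue. \<alpha> t * T H t))) \<le> M * (P * (B * q))"
proof -
  define v where "v t = exp (\<i> * \<mu> * of_real t) * y\<^sub>2 t" for t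
  define V where "V t = v t - (c + d * H t) - (c * K t + d * T H t)" for t
  have v: "continuous_on {0..1} v" "\<And>t. t \<in> {0..1} \<Longrightarrow> v t = c + d * H t + T v t"
    and u: "exp (- \<i> * \<mu> * of_real x) * y\<^sub>1 x = - d - (LINT t:{0..x}|lebesgue. \<alpha> t * v t)"
    using dirac_solution_integral_equations[OF sol] x \<open>y\<^sub>1 0 = - d\<close> \<open>y\<^sub>2 0 = c\<close>
    by (simp_all add: v_def[abs_def])
  have V: "continuous_on {0..1} V"
    unfolding V_def by (intro continuous_intros v continuous_on_H continuous_on_K continuous_on_T)
  have le: "cmod (V t) \<le> B * q" if "t \<in> {0..1}" for t
  proof -
    have "cmod (V t) \<le> (cmod c * (2 * M * S) + cmod d * (4 * M\<^sup>2 * S\<^sup>2)) * exp (M * S * P) * q"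
      unfolding V_def by (rule remainder_bound[OF v that])
    also have "\<dots> \<le> (1 * (2 * M * S) + 1 * (4 * M\<^sup>2 * S\<^sup>2)) * exp (M * S * P) * q"
      using cd one_le_M nonneg by (intro mult_right_mono add_mono) auto
    finally show ?thesis by (simp add: B_def)
  qed
  from le[OF x] show "cmod (exp (\<i> * \<mu> * of_real x) * y\<^sub>2 x - (c + d * H x) - (c * K x + d * T H x)) \<le> B * q"
    by (simp add: V_def v_def)
  note int = set_integrable_01_le_mult_continuous_on[OF set_integrable_\<alpha>, of _ x]
  \<comment> \<open>v is written as V plus the Neumann terms, so that only the integral of \<alpha>
    V remains to be estimated.\<close>
  have "(LINT t:{0..x}|lebesgue. \<alpha> t * v t) =
      (LINT t:{0..x}|lebesgue. \<alpha> t * V t + (c * \<alpha> t + d * (\<alpha> t * H t) + c * (\<alpha> t * K t) + d * (\<alpha> t * T H t)))"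
    by (simp add: V_def algebra_simps)
  also have "\<dots> = (LINT t:{0..x}|lebesgue. \<alpha> t * V t) + (c * A x + d * (LINT t:{0..x}|lebesgue. \<alpha> t * H t) +
      c * (LINT t:{0..x}|lebesgue. \<alpha> t * K t) + d * (LINT t:{0..x}|lebesgue. \<alpha> t * T H t))"
    using x int[OF V] int[OF continuous_on_H] int[OF continuous_on_K]
      int[OF continuous_on_T[OF continuous_on_H]] set_integrable_01_le[OF set_integrable_\<alpha>, of x]
    by (simp add: A_def)
  finally have \<alpha>v: "(LINT t:{0..x}|lebesgue. \<alpha> t * v t) = \<dots>" .
  have "exp (- \<i> * \<mu> * of_real x) * y\<^sub>1 x =
      - (LINT t:{0..x}|lebesgue. \<alpha> t * V t) - (d + c * A x + d * (LINT t:{0..x}|lebesgue. \<alpha> t * H t) +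
      c * (LINT t:{0..x}|lebesgue. \<alpha> t * K t) + d * (LINT t:{0..x}|lebesgue. \<alpha> t * T H t))"
    unfolding u \<alpha>v by simp
  moreover have "exp (\<i> * \<mu> * of_real x) = exp (2 * \<i> * \<mu> * of_real x) * exp (- \<i> * \<mu> * of_real x)"
    by (simp add: algebra_simps flip: exp_add)
  ultimately have "exp (\<i> * \<mu> * of_real x) * y\<^sub>1 x = exp (2 * \<i> * \<mu> * of_real x) *
      (- (LINT t:{0..x}|lebesgue. \<alpha> t * V t) - (d + c * A x + d * (LINT t:{0..x}|lebesgue. \<alpha> t * H t) +
      c * (LINT t:{0..x}|lebesgue. \<alpha> t * K t) + d * (LINT t:{0..x}|lebesgue. \<alpha> t * T H t)))"
    by (simp only: mult.assoc)
  then have eq: "exp (\<i> * \<mu> * of_real x) * y\<^sub>1 x + exp (2 * \<i> * \<mu> * of_real x) *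
      (d + c * A x + d * (LINT t:{0..x}|lebesgue. \<alpha> t * H t) + c * (LINT t:{0..x}|lebesgue. \<alpha> t * K t) +
       d * (LINT t:{0..x}|lebesgue. \<alpha> t * T H t)) =
      - (exp (2 * \<i> * \<mu> * of_real x) * (LINT t:{0..x}|lebesgue. \<alpha> t * V t))"
    by (simp add: algebra_simps)
  show "cmod (exp (\<i> * \<mu> * of_real x) * y\<^sub>1 x + exp (2 * \<i> * \<mu> * of_real x) *
      (d + c * A x + d * (LINT t:{0..x}|lebesgue. \<alpha> t * H t) + c * (LINT t:{0..x}|lebesgue. \<alpha> t * K t) +
       d * (LINT t:{0..x}|lebesgue. \<alpha> t * T H t))) \<le> M * (P * (B * q))"
    unfolding eq norm_minus_cancel using V le x by (rule norm_exp_mult_integral_\<alpha>_le)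
qed

section \<open>Identification with the stated expansions\<close>

text \<open>\<open>Q_term\<close> is the contribution of \<open>T H\<close> to the first component.
  The bound on \<open>T H\<close> is of first order in \<open>k\<close>, so this term is kept in the
  main part.\<close>

lemma Q_term_eq: "Q_term \<sigma>\<^sub>1 \<sigma>\<^sub>2 x \<mu> = exp (2 * \<i> * \<mu> * of_real x) * (LINT t:{0..x}|lebesgue. \<alpha> t * T H t)"
proof -
  \<comment> \<open>Splitting the difference in the exponent gives \<alpha> its exponential and
    completes \<open>\<sigma>\<^sub>2\<close> to \<beta>.\<close>
  have e: "exp (2 * \<i> * \<mu> * of_real (s - t)) = exp (2 * \<i> * \<mu> * of_real s) * exp (- 2 * \<i> * \<mu> * of_real t)" for s t
    by (simp add: algebra_simps flip: exp_add)
  have "(LINT \<tau>:{0..s}|lebesgue. exp (2 * \<i> * \<mu> * of_real (s - \<tau>)) * \<sigma>\<^sub>1 \<tau> * H \<tau>) =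
      exp (2 * \<i> * \<mu> * of_real s) * (LINT t:{0..s}|lebesgue. \<alpha> t * H t)" for s
    unfolding e \<alpha>_def by (simp only: mult.assoc set_integral_mult_right)
  then have "(LINT s:{0..t}|lebesgue. \<sigma>\<^sub>2 s *
      (LINT \<tau>:{0..s}|lebesgue. exp (2 * \<i> * \<mu> * of_real (s - \<tau>)) * \<sigma>\<^sub>1 \<tau> * H \<tau>)) = T H t" for t
    by (simp add: T_def \<beta>_def mult_ac)
  then show ?thesis
    unfolding Q_term_def \<beta>_def[symmetric] H_def[symmetric] e \<alpha>_def
    by (simp only: mult.assoc set_integral_mult_right)
qed

text \<open>The expansion of \<open>s\<^sub>1\<close> has the \<beta> integration outermost, whereas
  the Neumann series yields the integral of \<alpha> K; Fubini on the triangle connects the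
  two.\<close>

lemma integral_\<beta>_integral_\<alpha>_A:
  assumes "x \<in> {0..1}"
  shows "(LINT s:{0..x}|lebesgue. \<beta> s * (LINT t:{s..x}|lebesgue. \<alpha> t * A s)) =
    (LINT t:{0..x}|lebesgue. \<alpha> t * K t)"
proof -
  have "(LINT t:{0..x}|lebesgue. \<alpha> t * K t) = (LINT s:{0..x}|lebesgue. \<beta> s * A s * (LINT t:{s..x}|lebesgue. \<alpha> t))"
    using assms unfolding K_def
    by (intro set_lebesgue_integral_Icc_swap set_integrable_01_le_mult_continuous_on
        set_integrable_01_le[OF set_integrable_\<alpha>] set_integrable_\<beta> continuous_on_A) auto
  then show ?thesis
    by (simp add: mult_ac)
qed

lemma q_le_gamma_tilde: "q \<le> gamma_tilde \<sigma>\<^sub>1 \<sigma>\<^sub>2 \<mu>"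
proof -
  have "0 \<le> (LINT s:{0..1}|lebesgue. cmod (\<sigma>\<^sub>1 s) * (gamma02 \<sigma>\<^sub>2 s \<mu>)\<^sup>2)"
    unfolding set_lebesgue_integral_def by (auto intro!: Bochner_Integration.integral_nonneg)
  then show ?thesis
    by (simp add: gamma_tilde_def q_def)
qed

lemma exp_\<mu>_mult:
  "exp (\<i> * \<mu> * of_real x) * exp (\<i> * \<mu> * of_real x) = exp (2 * \<i> * \<mu> * of_real x)"
  "exp (\<i> * \<mu> * of_real x) * exp (- \<i> * \<mu> * of_real x) = 1"
  by (simp_all add: algebra_simps flip: exp_add)

lemma cosine_remainder:
  assumes sol: "dirac_solution \<sigma>\<^sub>1 \<sigma>\<^sub>2 \<mu> c\<^sub>1 c\<^sub>2" and init: "c\<^sub>1 0 = 1" "c\<^sub>2 0 = 0" and x: "x \<in> {0..1}"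
  defines "B \<equiv> (2 * M * S + 4 * M\<^sup>2 * S\<^sup>2) * exp (M * S * P)"
  shows "cmod (exp (\<i> * \<mu> * of_real x) * (c\<^sub>1 x -
      (exp (\<i> * \<mu> * of_real x) *
         (1 + (LINT s:{0..x}|lebesgue. exp (- 2 * \<i> * \<mu> * of_real s) * \<sigma>\<^sub>1 s *
                (LINT \<xi>:{0..s}|lebesgue. exp (2 * \<i> * \<mu> * of_real \<xi>) * \<sigma>\<^sub>2 \<xi>)))
       + exp (- \<i> * \<mu> * of_real x) * Q_term \<sigma>\<^sub>1 \<sigma>\<^sub>2 x \<mu>))) \<le> M * P * B * q"
    and "cmod (exp (\<i> * \<mu> * of_real x) * (c\<^sub>2 x -
      exp (- \<i> * \<mu> * of_real x) *
        (- (LINT t:{0..x}|lebesgue. exp (2 * \<i> * \<mu> * of_real t) * \<sigma>\<^sub>2 t)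
         - (LINT t:{0..x}|lebesgue. exp (2 * \<i> * \<mu> * of_real t) * \<sigma>\<^sub>2 t *
              (LINT s:{0..t}|lebesgue. exp (- 2 * \<i> * \<mu> * of_real s) * \<sigma>\<^sub>1 s *
                (LINT \<tau>:{0..s}|lebesgue. exp (2 * \<i> * \<mu> * of_real \<tau>) * \<sigma>\<^sub>2 \<tau>)))))) \<le> B * q"
proof -
  \<comment> \<open>The initial values (1, 0) correspond to d = -1 and c = 0.\<close>
  note rem = exp_solution_remainder[OF sol, of "- 1" 0, simplified init, simplified, OF x[simplified], folded B_def]
  have "exp (\<i> * \<mu> * of_real x) * (c\<^sub>1 x - (exp (\<i> * \<mu> * of_real x) * (1 + (LINT s:{0..x}|lebesgue. \<alpha> s * H s))
       + exp (- \<i> * \<mu> * of_real x) * Q_term \<sigma>\<^sub>1 \<sigma>\<^sub>2 x \<mu>)) =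
    exp (\<i> * \<mu> * of_real x) * c\<^sub>1 x - exp (2 * \<i> * \<mu> * of_real x) * (1 + (LINT s:{0..x}|lebesgue. \<alpha> s * H s))
       - Q_term \<sigma>\<^sub>1 \<sigma>\<^sub>2 x \<mu>"
    unfolding right_diff_distrib distrib_left[of "exp (\<i> * \<mu> * of_real x)"] mult.assoc[symmetric] exp_\<mu>_mult
    by (simp add: algebra_simps)
  then show "cmod (exp (\<i> * \<mu> * of_real x) * (c\<^sub>1 x -
      (exp (\<i> * \<mu> * of_real x) *
         (1 + (LINT s:{0..x}|lebesgue. exp (- 2 * \<i> * \<mu> * of_real s) * \<sigma>\<^sub>1 s *
                (LINT \<xi>:{0..s}|lebesgue. exp (2 * \<i> * \<mu> * of_real \<xi>) * \<sigma>\<^sub>2 \<xi>)))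
       + exp (- \<i> * \<mu> * of_real x) * Q_term \<sigma>\<^sub>1 \<sigma>\<^sub>2 x \<mu>))) \<le> M * P * B * q"
    unfolding \<alpha>_def[symmetric] \<beta>_def[symmetric] H_def[symmetric]
    using rem(2) by (simp add: Q_term_eq algebra_simps)
  have "exp (\<i> * \<mu> * of_real x) * (c\<^sub>2 x - exp (- \<i> * \<mu> * of_real x) * (- H x - T H x)) =
      exp (\<i> * \<mu> * of_real x) * c\<^sub>2 x + H x + T H x"
    unfolding right_diff_distrib mult.assoc[symmetric] exp_\<mu>_mult by simp
  then show "cmod (exp (\<i> * \<mu> * of_real x) * (c\<^sub>2 x -
      exp (- \<i> * \<mu> * of_real x) *
        (- (LINT t:{0..x}|lebesgue. exp (2 * \<i> * \<mu> * of_real t) * \<sigma>\<^sub>2 t)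
         - (LINT t:{0..x}|lebesgue. exp (2 * \<i> * \<mu> * of_real t) * \<sigma>\<^sub>2 t *
              (LINT s:{0..t}|lebesgue. exp (- 2 * \<i> * \<mu> * of_real s) * \<sigma>\<^sub>1 s *
                (LINT \<tau>:{0..s}|lebesgue. exp (2 * \<i> * \<mu> * of_real \<tau>) * \<sigma>\<^sub>2 \<tau>)))))) \<le> B * q"
    unfolding \<alpha>_def[symmetric] \<beta>_def[symmetric] H_def[symmetric] T_def[symmetric]
    using rem(1) by simp
qed

lemma sine_remainder:
  assumes sol: "dirac_solution \<sigma>\<^sub>1 \<sigma>\<^sub>2 \<mu> s\<^sub>1 s\<^sub>2" and init: "s\<^sub>1 0 = 0" "s\<^sub>2 0 = 1" and x: "x \<in> {0..1}"
  defines "B \<equiv> (2 * M * S + 4 * M\<^sup>2 * S\<^sup>2) * exp (M * S * P)"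
  shows "cmod (exp (\<i> * \<mu> * of_real x) * (s\<^sub>1 x -
      exp (\<i> * \<mu> * of_real x) *
        (- (LINT t:{0..x}|lebesgue. exp (- 2 * \<i> * \<mu> * of_real t) * \<sigma>\<^sub>1 t)
         - (LINT s:{0..x}|lebesgue. exp (2 * \<i> * \<mu> * of_real s) * \<sigma>\<^sub>2 s *
              (LINT t:{s..x}|lebesgue. exp (- 2 * \<i> * \<mu> * of_real t) * \<sigma>\<^sub>1 t *
                (LINT \<tau>:{0..s}|lebesgue. exp (- 2 * \<i> * \<mu> * of_real \<tau>) * \<sigma>\<^sub>1 \<tau>)))))) \<le> M * P * B * q"
    and "cmod (exp (\<i> * \<mu> * of_real x) * (s\<^sub>2 x -
      exp (- \<i> * \<mu> * of_real x) *
        (1 + (LINT t:{0..x}|lebesgue. \<sigma>\<^sub>2 t * exp (2 * \<i> * \<mu> * of_real t) *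
               (LINT s:{0..t}|lebesgue. \<sigma>\<^sub>1 s * exp (- 2 * \<i> * \<mu> * of_real s)))))) \<le> B * q"
proof -
  \<comment> \<open>The initial values (0, 1) correspond to d = 0 and c = 1.\<close>
  note rem = exp_solution_remainder[OF sol, of 0 1, simplified init, simplified, OF x[simplified], folded B_def]
  have "exp (\<i> * \<mu> * of_real x) * (s\<^sub>1 x -
      exp (\<i> * \<mu> * of_real x) * (- A x - (LINT t:{0..x}|lebesgue. \<alpha> t * K t))) =
    exp (\<i> * \<mu> * of_real x) * s\<^sub>1 x +
      exp (2 * \<i> * \<mu> * of_real x) * (A x + (LINT t:{0..x}|lebesgue. \<alpha> t * K t))"
    unfolding right_diff_distrib[of "exp (\<i> * \<mu> * of_real x)" "s\<^sub>1 x"] mult.assoc[symmetric] exp_\<mu>_mult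
    by (simp add: algebra_simps)
  then show "cmod (exp (\<i> * \<mu> * of_real x) * (s\<^sub>1 x -
      exp (\<i> * \<mu> * of_real x) *
        (- (LINT t:{0..x}|lebesgue. exp (- 2 * \<i> * \<mu> * of_real t) * \<sigma>\<^sub>1 t)
         - (LINT s:{0..x}|lebesgue. exp (2 * \<i> * \<mu> * of_real s) * \<sigma>\<^sub>2 s *
              (LINT t:{s..x}|lebesgue. exp (- 2 * \<i> * \<mu> * of_real t) * \<sigma>\<^sub>1 t *
                (LINT \<tau>:{0..s}|lebesgue. exp (- 2 * \<i> * \<mu> * of_real \<tau>) * \<sigma>\<^sub>1 \<tau>)))))) \<le> M * P * B * q"
    unfolding \<alpha>_def[symmetric] \<beta>_def[symmetric] A_def[symmetric] integral_\<beta>_integral_\<alpha>_A[OF x]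
    using rem(2) by (simp add: mult.assoc)
  have comm: "\<sigma>\<^sub>2 t * exp (2 * \<i> * \<mu> * of_real t) = \<beta> t" "\<sigma>\<^sub>1 t * exp (- 2 * \<i> * \<mu> * of_real t) = \<alpha> t" for t
    by (simp_all add: \<alpha>_def \<beta>_def)
  have "exp (\<i> * \<mu> * of_real x) * (s\<^sub>2 x - exp (- \<i> * \<mu> * of_real x) * (1 + K x)) =
      exp (\<i> * \<mu> * of_real x) * s\<^sub>2 x - 1 - K x"
    unfolding right_diff_distrib mult.assoc[symmetric] exp_\<mu>_mult by simp
  then show "cmod (exp (\<i> * \<mu> * of_real x) * (s\<^sub>2 x -
      exp (- \<i> * \<mu> * of_real x) *
        (1 + (LINT t:{0..x}|lebesgue. \<sigma>\<^sub>2 t * exp (2 * \<i> * \<mu> * of_real t) *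
               (LINT s:{0..t}|lebesgue. \<sigma>\<^sub>1 s * exp (- 2 * \<i> * \<mu> * of_real s)))))) \<le> B * q"
    unfolding comm A_def[symmetric] K_def[symmetric] using rem(1) by simp
qed

end

section \<open>From L^p coefficients and a single \<mu> to uniform estimates\<close>

lemma set_integrable_Lp01:
  assumes "f \<in> Lp01 p" "1 \<le> p"
  shows "set_integrable lebesgue {0..1} f"
proof -
  \<comment> \<open>The modulus is at most 1 or, since p >= 1, at most its p-th power; the constant
    1 is integrable on [0,1].\<close>
  have "cmod (f x) \<le> 1 + cmod (f x) powr p" for x
    using powr_mono[of 1 p "cmod (f x)"] assms(2) by (cases "cmod (f x) \<le> 1") (auto intro: add_increasing2)
  then have "integrable (lebesgue_on {0..1}) f"
    using assms(1)
    by (intro Bochner_Integration.integrable_bound[of _ "\<lambda>x. 1 + cmod (f x) powr p" f])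
      (auto simp: Lp01_def intro!: AE_I2 Bochner_Integration.integrable_add order_trans[OF _ abs_ge_self])
  then show ?thesis
    by (simp add: integrable_lebesgue_on_Icc_iff)
qed

text \<open>The modulus is \<open>exp (- 2 * Im \<mu> * t)\<close>, and the exponent is at most 2 r
  t, hence at most 2 r. This supplies the constant \<open>M\<close>.\<close>

lemma norm_exp_le_Sigma_half_plane:
  assumes "\<mu> \<in> Sigma_half_plane r" "0 \<le> r" "t \<in> {0..1}"
  shows "cmod (exp (2 * \<i> * \<mu> * of_real t)) \<le> exp (2 * r)"
proof -
  have "- Im \<mu> * t \<le> r * t"
    using assms by (intro mult_right_mono) (auto simp: Sigma_half_plane_def)
  also have "\<dots> \<le> r"
    using assms by (simp add: mult_left_le)
  finally show ?thesis by (simp add: mult.commute)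
qed

lemma bigO_unifI:
  assumes "\<And>x \<mu>. x \<in> {0..1} \<Longrightarrow> \<mu> \<in> Sigma_half_plane r \<Longrightarrow> cmod (E x \<mu>) \<le> C * g \<mu>"
  shows "E \<in> bigO_unif r g"
  \<comment> \<open>The threshold 0 works because the bounds hold on the whole half-plane and not
    just for large \<mu>.\<close>
  unfolding bigO_unif_def using assms by (intro CollectI exI[of _ C] exI[of _ 0]) blast

text \<open>The error term is defined by solving the claimed identity for it, so the identity holds
  for all \<mu> and x and only the bound carries content.\<close>

lemma ex_bigO_unif_remainder:
  assumes "\<And>x \<mu>. x \<in> {0..1} \<Longrightarrow> \<mu> \<in> Sigma_half_plane r \<Longrightarrow>
    cmod (exp (\<i> * \<mu> * of_real x) * (y \<mu> x - m \<mu> x)) \<le> C * g \<mu>"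
  obtains E where "E \<in> bigO_unif r g" "\<And>\<mu> x. y \<mu> x = m \<mu> x + exp (- \<i> * \<mu> * of_real x) * E x \<mu>"
proof
  show "(\<lambda>x \<mu>. exp (\<i> * \<mu> * of_real x) * (y \<mu> x - m \<mu> x)) \<in> bigO_unif r g"
    using assms by (rule bigO_unifI)
  show "y \<mu> x = m \<mu> x + exp (- \<i> * \<mu> * of_real x) * (exp (\<i> * \<mu> * of_real x) * (y \<mu> x - m \<mu> x))" for \<mu> x
    unfolding mult.assoc[symmetric, of "exp (- \<i> * \<mu> * of_real x)"] by (simp flip: exp_add)
qed

theorem theorem4p1:
  fixes p r :: real
    and \<sigma>\<^sub>1 \<sigma>\<^sub>2 :: "real \<Rightarrow> complex"
    and c\<^sub>1 c\<^sub>2 s\<^sub>1 s\<^sub>2 :: "complex \<Rightarrow> real \<Rightarrow> complex"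
  assumes "1 \<le> p" and "p \<le> 2"
    and "\<sigma>\<^sub>1 \<in> Lp01 p" and "\<sigma>\<^sub>2 \<in> Lp01 p"
    and "0 \<le> r"
    and "\<And>\<mu>. \<mu> \<in> Sigma_half_plane r \<Longrightarrow> dirac_solution \<sigma>\<^sub>1 \<sigma>\<^sub>2 \<mu> (c\<^sub>1 \<mu>) (c\<^sub>2 \<mu>)"
    and "\<And>\<mu>. \<mu> \<in> Sigma_half_plane r \<Longrightarrow> c\<^sub>1 \<mu> 0 = 1 \<and> c\<^sub>2 \<mu> 0 = 0"
    and "\<And>\<mu>. \<mu> \<in> Sigma_half_plane r \<Longrightarrow> dirac_solution \<sigma>\<^sub>1 \<sigma>\<^sub>2 \<mu> (s\<^sub>1 \<mu>) (s\<^sub>2 \<mu>)"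
    and "\<And>\<mu>. \<mu> \<in> Sigma_half_plane r \<Longrightarrow> s\<^sub>1 \<mu> 0 = 0 \<and> s\<^sub>2 \<mu> 0 = 1"
  shows "\<exists>E\<^sub>1 \<in> bigO_unif r (gamma_tilde \<sigma>\<^sub>1 \<sigma>\<^sub>2). \<exists>E\<^sub>2 \<in> bigO_unif r (gamma_tilde \<sigma>\<^sub>1 \<sigma>\<^sub>2).
         \<exists>E\<^sub>3 \<in> bigO_unif r (gamma_tilde \<sigma>\<^sub>1 \<sigma>\<^sub>2). \<exists>E\<^sub>4 \<in> bigO_unif r (gamma_tilde \<sigma>\<^sub>1 \<sigma>\<^sub>2).
         \<forall>\<mu>\<in>Sigma_half_plane r. \<forall>x\<in>{0..1}.
           c\<^sub>1 \<mu> x =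
             exp (\<i> * \<mu> * of_real x) *
               (1 + (LINT s:{0..x}|lebesgue. exp (- 2 * \<i> * \<mu> * of_real s) * \<sigma>\<^sub>1 s *
                      (LINT \<xi>:{0..s}|lebesgue. exp (2 * \<i> * \<mu> * of_real \<xi>) * \<sigma>\<^sub>2 \<xi>)))
             + exp (- \<i> * \<mu> * of_real x) * Q_term \<sigma>\<^sub>1 \<sigma>\<^sub>2 x \<mu>
             + exp (- \<i> * \<mu> * of_real x) * E\<^sub>1 x \<mu> \<and>
           c\<^sub>2 \<mu> x =
             exp (- \<i> * \<mu> * of_real x) *
               (- (LINT t:{0..x}|lebesgue. exp (2 * \<i> * \<mu> * of_real t) * \<sigma>\<^sub>2 t)
                - (LINT t:{0..x}|lebesgue. exp (2 * \<i> * \<mu> * of_real t) * \<sigma>\<^sub>2 t *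
                    (LINT s:{0..t}|lebesgue. exp (- 2 * \<i> * \<mu> * of_real s) * \<sigma>\<^sub>1 s *
                      (LINT \<tau>:{0..s}|lebesgue. exp (2 * \<i> * \<mu> * of_real \<tau>) * \<sigma>\<^sub>2 \<tau>))))
             + exp (- \<i> * \<mu> * of_real x) * E\<^sub>2 x \<mu> \<and>
           s\<^sub>1 \<mu> x =
             exp (\<i> * \<mu> * of_real x) *
               (- (LINT t:{0..x}|lebesgue. exp (- 2 * \<i> * \<mu> * of_real t) * \<sigma>\<^sub>1 t)
                - (LINT s:{0..x}|lebesgue. exp (2 * \<i> * \<mu> * of_real s) * \<sigma>\<^sub>2 s *
                    (LINT t:{s..x}|lebesgue. exp (- 2 * \<i> * \<mu> * of_real t) * \<sigma>\<^sub>1 t *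
                      (LINT \<tau>:{0..s}|lebesgue. exp (- 2 * \<i> * \<mu> * of_real \<tau>) * \<sigma>\<^sub>1 \<tau>))))
             + exp (- \<i> * \<mu> * of_real x) * E\<^sub>3 x \<mu> \<and>
           s\<^sub>2 \<mu> x =
             exp (- \<i> * \<mu> * of_real x) *
               (1 + (LINT t:{0..x}|lebesgue. \<sigma>\<^sub>2 t * exp (2 * \<i> * \<mu> * of_real t) *
                      (LINT s:{0..t}|lebesgue. \<sigma>\<^sub>1 s * exp (- 2 * \<i> * \<mu> * of_real s))))
             + exp (- \<i> * \<mu> * of_real x) * E\<^sub>4 x \<mu>"
proof -
  \<comment> \<open>\<open>S\<close> and \<open>P\<close> depend on one coefficient each and
    \<open>M\<close> on r alone, so the constant \<open>B\<close> serves the whole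
    half-plane.\<close>
  define S where "S = dirac_kernels.S \<sigma>\<^sub>2"
  define P where "P = dirac_kernels.P \<sigma>\<^sub>1"
  define M where "M = exp (2 * r)"
  define B where "B = (2 * M * S + 4 * M\<^sup>2 * S\<^sup>2) * exp (M * S * P)"
  have loc: "dirac_kernels \<sigma>\<^sub>1 \<sigma>\<^sub>2 \<mu> M" if "\<mu> \<in> Sigma_half_plane r" for \<mu>
    unfolding M_def
    using set_integrable_Lp01[OF assms(3,1)] set_integrable_Lp01[OF assms(4,1)]
      norm_exp_le_Sigma_half_plane[OF that assms(5)]
    by (rule dirac_kernels.intro)
  have q: "C * dirac_kernels.q \<sigma>\<^sub>1 \<sigma>\<^sub>2 \<mu> \<le> C * gamma_tilde \<sigma>\<^sub>1 \<sigma>\<^sub>2 \<mu>"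
    if "\<mu> \<in> Sigma_half_plane r" "0 \<le> C" for \<mu> C
    using dirac_kernels.q_le_gamma_tilde[OF loc[OF that(1)]] that(2) by (rule mult_left_mono)
  \<comment> \<open>A sample point of the half-plane, used to read off the signs of the \<mu>-free
    constants from the locale.\<close>
  have "\<i> \<in> Sigma_half_plane r"
    using assms(5) by (simp add: Sigma_half_plane_def)
  from dirac_kernels.nonneg[OF loc[OF this]] have nonneg: "0 \<le> S" "0 \<le> P"
    by (simp_all add: S_def P_def)
  have "0 < M"
    by (simp add: M_def)
  with nonneg have B: "0 \<le> B" "0 \<le> M * P * B"
    by (simp_all add: B_def)
  note c = dirac_kernels.cosine_remainder[OF loc assms(6) conjunct1[OF assms(7)] conjunct2[OF assms(7)],
      folded S_def P_def, folded B_def]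
  note s = dirac_kernels.sine_remainder[OF loc assms(8) conjunct1[OF assms(9)] conjunct2[OF assms(9)],
      folded S_def P_def, folded B_def]
  \<comment> \<open>First components get the constant \<open>M * P * B\<close>, from the extra
    integration against \<alpha>; second components get \<open>B\<close>.\<close>
  from ex_bigO_unif_remainder[OF order_trans[OF c(1) q[OF _ B(2)]]]
  obtain E\<^sub>1 where E\<^sub>1: "E\<^sub>1 \<in> bigO_unif r (gamma_tilde \<sigma>\<^sub>1 \<sigma>\<^sub>2)"
    "\<And>\<mu> x. c\<^sub>1 \<mu> x = exp (\<i> * \<mu> * of_real x) *
         (1 + (LINT s:{0..x}|lebesgue. exp (- 2 * \<i> * \<mu> * of_real s) * \<sigma>\<^sub>1 s *
                (LINT \<xi>:{0..s}|lebesgue. exp (2 * \<i> * \<mu> * of_real \<xi>) * \<sigma>\<^sub>2 \<xi>)))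
       + exp (- \<i> * \<mu> * of_real x) * Q_term \<sigma>\<^sub>1 \<sigma>\<^sub>2 x \<mu> + exp (- \<i> * \<mu> * of_real x) * E\<^sub>1 x \<mu>"
    by blast
  from ex_bigO_unif_remainder[OF order_trans[OF c(2) q[OF _ B(1)]]]
  obtain E\<^sub>2 where E\<^sub>2: "E\<^sub>2 \<in> bigO_unif r (gamma_tilde \<sigma>\<^sub>1 \<sigma>\<^sub>2)"
    "\<And>\<mu> x. c\<^sub>2 \<mu> x = exp (- \<i> * \<mu> * of_real x) *
        (- (LINT t:{0..x}|lebesgue. exp (2 * \<i> * \<mu> * of_real t) * \<sigma>\<^sub>2 t)
         - (LINT t:{0..x}|lebesgue. exp (2 * \<i> * \<mu> * of_real t) * \<sigma>\<^sub>2 t *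
              (LINT s:{0..t}|lebesgue. exp (- 2 * \<i> * \<mu> * of_real s) * \<sigma>\<^sub>1 s *
                (LINT \<tau>:{0..s}|lebesgue. exp (2 * \<i> * \<mu> * of_real \<tau>) * \<sigma>\<^sub>2 \<tau>))))
       + exp (- \<i> * \<mu> * of_real x) * E\<^sub>2 x \<mu>"
    by blast
  from ex_bigO_unif_remainder[OF order_trans[OF s(1) q[OF _ B(2)]]]
  obtain E\<^sub>3 where E\<^sub>3: "E\<^sub>3 \<in> bigO_unif r (gamma_tilde \<sigma>\<^sub>1 \<sigma>\<^sub>2)"
    "\<And>\<mu> x. s\<^sub>1 \<mu> x = exp (\<i> * \<mu> * of_real x) *
        (- (LINT t:{0..x}|lebesgue. exp (- 2 * \<i> * \<mu> * of_real t) * \<sigma>\<^sub>1 t)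
         - (LINT s:{0..x}|lebesgue. exp (2 * \<i> * \<mu> * of_real s) * \<sigma>\<^sub>2 s *
              (LINT t:{s..x}|lebesgue. exp (- 2 * \<i> * \<mu> * of_real t) * \<sigma>\<^sub>1 t *
                (LINT \<tau>:{0..s}|lebesgue. exp (- 2 * \<i> * \<mu> * of_real \<tau>) * \<sigma>\<^sub>1 \<tau>))))
       + exp (- \<i> * \<mu> * of_real x) * E\<^sub>3 x \<mu>"
    by blast
  from ex_bigO_unif_remainder[OF order_trans[OF s(2) q[OF _ B(1)]]]
  obtain E\<^sub>4 where E\<^sub>4: "E\<^sub>4 \<in> bigO_unif r (gamma_tilde \<sigma>\<^sub>1 \<sigma>\<^sub>2)"
    "\<And>\<mu> x. s\<^sub>2 \<mu> x = exp (- \<i> * \<mu> * of_real x) *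
        (1 + (LINT t:{0..x}|lebesgue. \<sigma>\<^sub>2 t * exp (2 * \<i> * \<mu> * of_real t) *
               (LINT s:{0..t}|lebesgue. \<sigma>\<^sub>1 s * exp (- 2 * \<i> * \<mu> * of_real s))))
       + exp (- \<i> * \<mu> * of_real x) * E\<^sub>4 x \<mu>"
    by blast
  show ?thesis
    by (intro bexI[OF _ E\<^sub>1(1)] bexI[OF _ E\<^sub>2(1)] bexI[OF _ E\<^sub>3(1)] bexI[OF _ E\<^sub>4(1)] ballI conjI
        E\<^sub>1(2) E\<^sub>2(2) E\<^sub>3(2) E\<^sub>4(2))
qed

end
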